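(* There exists a constant $\gamma>0.04$ such that the following holds. Let $f:\{0,1\}^{m}\to\{0,1\}$, let $n\in\mathbb{N}$, and let $\Pi$ be a partially half-duplex protocol that solves $\mathit{KW}_f\circledast\mathit{MUX}_n$. For every $\gamma$-alive transcript $\pi_1$ of $\Pi$, the complexity of $\Pi$ is at least $|\pi_1|+n-O(\log(m\cdot n))$, where the $O(\cdot)$ hides a universal constant.
   Context: Logs base 2. For $g:\{0,1\}^n\to\{0,1\}$ and $X\in\{0,1\}^{m\times n}$, $g(X)\in\{0,1\}^m$ applies $g$ to each row, $(f\diamond g)(X)=f(g(X))$, and for $a\in\{0,1\}^m$, $g^{-1}(a)=\{X: g(X)=a\}$. $\mathit{KW}_f\circledast\mathit{MUX}_n$: Alice gets $g_A:\{0,1\}^n\to\{0,1\}$ and $X\in\{0,1\}^{m\times n}$ with $(f\diamond g_A)(X)=1$; Bob gets $g_B$ and $Y$ with $(f\diamond g_B)(Y)=0$; with $a=g_A(X)$, $b=g_B(Y)$ they must output $(i,j)$ with $a_i\neq b_i$ and $X_{i,j}\neq Y_{i,j}$, or may output $\bot$ if $g_A\neq g_B$. Half-duplex protocol: a pair of full 4-ary trees $\Pi_A,\Pi_B$ of equal depth (the complexity). Each vertex $u$ of $\Pi_A$ is labeled by a set $\mathcal{X}_u$ of Alice inputs (root: all inputs); the children of internal $u$ are $u_{\mathrm{rcv}(0)},u_{\mathrm{rcv}(1)},u_{\mathrm{send}(0)},u_{\mathrm{send}(1)}$ with $\mathcal{X}_{u_{\mathrm{rcv}(0)}}=\mathcal{X}_{u_{\mathrm{rcv}(1)}}$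 and $\mathcal{X}_u$ the disjoint union of $\mathcal{X}_{u_{\mathrm{rcv}(0)}},\mathcal{X}_{u_{\mathrm{send}(0)}},\mathcal{X}_{u_{\mathrm{send}(1)}}$; similarly $\Pi_B$ with Bob's inputs. Leaves carry outputs. Execution from the roots $(u,v)$: if one player's input lies in a send set $\mathrm{send}(\sigma)$ and the other's in the receive set, both move along edges labeled $\mathrm{send}(\sigma)$ / $\mathrm{rcv}(\sigma)$ respectively (classical round); if both send $\sigma,\tau$, they move to $\mathrm{send}(\sigma)$, $\mathrm{send}(\tau)$ (wasted); if both receive, they move to $\mathrm{rcv}(\sigma)$, $\mathrm{rcv}(\tau)$ for adversarial $\sigma,\tau$ (silent). Both must reach leaves at the same round with the same output, and $\Pi$ solves the problem if all possible outputs are valid. $\Pi$ is partially half-duplex if whenever $g_A=g_B$ all rounds of every execution are classical. Transcripts: for $\pi\in\{0,1\}^*$, a vertex of $\Pi_A$ at depth $|\pi|$ is consistent with $\pi$ if the $i$-th edge on its root path is labeled $\mathrm{rcv}(\pi_i)$ or $\mathrm{send}(\pi_i)$ for all $i$; an Alice input is consistent with $\pi$ if it belongs to $\mathcal{X}_u$ for such a vertex $u$; similarly for Bob. $\mathcal{X}_\pi,\mathcal{Y}_\pi$ are the sets of consistent inputs of Alice and Bob; $\pi$ is a transcript if both are non-empty. For $g:\{0,1\}^n\to\{0,1\}$, $a\in f^{-1}(1)$, $b\in f^{-1}(0)$: $\mathcal{X}_\pi(g)=\{X:(g,X)\in\mathcal{X}_\pi\}$, $\mathcal{Y}_\pi(g)=\{Y:(g,Y)\in\mathcal{Y}_\pi\}$,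 $\mathcal{X}_\pi(g,a)=\mathcal{X}_\pi(g)\cap g^{-1}(a)$, $\mathcal{Y}_\pi(g,b)=\mathcal{Y}_\pi(g)\cap g^{-1}(b)$; $\mathcal{A}_\pi(g)$ ($\mathcal{B}_\pi(g)$) is the set of $a\in f^{-1}(1)$ ($b\in f^{-1}(0)$) with $\mathcal{X}_\pi(g,a)$ ($\mathcal{Y}_\pi(g,b)$) non-empty; $\mathcal{V}_\pi$ is the set of $g$ with both $\mathcal{A}_\pi(g),\mathcal{B}_\pi(g)$ non-empty. $\mathcal{V}_0$ is the set of balanced functions $\{0,1\}^n\to\{0,1\}$. Formula complexity of a rectangle: for disjoint $\mathcal{A},\mathcal{B}\subseteq\{0,1\}^m$, $\mathsf{L}(\mathcal{A}\times\mathcal{B})$ is the minimal number of leaves of a de Morgan formula $\phi$ with $\phi(\mathcal{A})=1$, $\phi(\mathcal{B})=0$ (defined as $0$ if either set is empty). Liveness (with the constant $\kappa=8$): a transcript $\pi_1$ is $\gamma$-alive if there is a set $\mathcal{V}\subseteq\mathcal{V}_{\pi_1}$ of balanced functions such that (i) $|\mathcal{V}|\ge2^{-m}|\mathcal{V}_0|$; (ii) for every $g\in\mathcal{V}$, $\log\mathsf{L}(\mathcal{A}_{\pi_1}(g)\times\mathcal{B}_{\pi_1}(g))\ge(1-\gamma)m+\kappa\log m+\kappa$; (iii) for every $g\in\mathcal{V}$, $a\in\mathcal{A}_{\pi_1}(g)$, $b\in\mathcal{B}_{\pi_1}(g)$: $|\mathcal{X}_{\pi_1}(g,a)|\ge2^{-\gamma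 m+1}|g^{-1}(a)|$ and $|\mathcal{Y}_{\pi_1}(g,b)|\ge2^{-\gamma m+1}|g^{-1}(b)|$. *)

theory Defs
  imports Complex_Main "HOL-Library.FuncSet"
begin

section \<open>Bit strings, Boolean matrices and Boolean functions\<close>

text \<open>
  Strings in \<open>{0,1}^n\<close> are Boolean lists of length \<open>n\<close>; an \<open>m \<times> n\<close> matrix is the list of its
  \<open>m\<close> rows.  Indices therefore start at 0.
\<close>

definition cube :: "nat \<Rightarrow> bool list set" where
  "cube n = {x. length x = n}"

definition matrices :: "nat \<Rightarrow> nat \<Rightarrow> bool list list set" where
  "matrices m n = {X. length X = m \<and> set X \<subseteq> cube n}"

text \<open>
  Functions \<open>{0,1}^n \<rightarrow> {0,1}\<close> are taken to be extensional (\<open>undefined\<close> off the cube), so that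
  HOL equality of such functions is equality on the cube and there are \<open>2^(2^n)\<close> of them.
\<close>

definition bool_funs :: "nat \<Rightarrow> (bool list \<Rightarrow> bool) set" where
  "bool_funs n = cube n \<rightarrow>\<^sub>E UNIV"

definition balanced_funs :: "nat \<Rightarrow> (bool list \<Rightarrow> bool) set" where
  "balanced_funs n =
     {g \<in> bool_funs n. card {x \<in> cube n. g x} = card {x \<in> cube n. \<not> g x}}"

text \<open>The matrix \<open>g(X)\<close> is \<^term>\<open>map g X\<close>.\<close>

definition row_preimage :: "nat \<Rightarrow> nat \<Rightarrow> (bool list \<Rightarrow> bool) \<Rightarrow> bool list \<Rightarrow> bool list list set" where
  "row_preimage m n g a = {X \<in> matrices m n. map g X = a}"

section \<open>De Morgan formulas and the formula complexity of a rectangle\<close>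

text \<open>The literal \<open>Lit s i\<close> is \<open>x\<^sub>i\<close> if \<open>s\<close> is true and its negation otherwise.\<close>

datatype formula = Lit bool nat | And formula formula | Or formula formula

primrec formula_vars :: "formula \<Rightarrow> nat set" where
  "formula_vars (Lit s i) = {i}"
| "formula_vars (And \<phi> \<psi>) = formula_vars \<phi> \<union> formula_vars \<psi>"
| "formula_vars (Or \<phi> \<psi>) = formula_vars \<phi> \<union> formula_vars \<psi>"

primrec formula_val :: "formula \<Rightarrow> bool list \<Rightarrow> bool" where
  "formula_val (Lit s i) x \<longleftrightarrow> x ! i = s"
| "formula_val (And \<phi> \<psi>) x \<longleftrightarrow> formula_val \<phi> x \<and> formula_val \<psi> x"
| "formula_val (Or \<phi> \<psi>) x \<longleftrightarrow> formula_val \<phi> x \<or> formula_val \<psi> x"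

primrec formula_leaves :: "formula \<Rightarrow> nat" where
  "formula_leaves (Lit s i) = 1"
| "formula_leaves (And \<phi> \<psi>) = formula_leaves \<phi> + formula_leaves \<psi>"
| "formula_leaves (Or \<phi> \<psi>) = formula_leaves \<phi> + formula_leaves \<psi>"

definition rect_formula_complexity :: "nat \<Rightarrow> bool list set \<Rightarrow> bool list set \<Rightarrow> nat" where
  "rect_formula_complexity m A B =
     (if A = {} \<or> B = {} then 0
      else LEAST k. \<exists>\<phi>. formula_leaves \<phi> = k \<and> formula_vars \<phi> \<subseteq> {..<m} \<and>
                        (\<forall>a\<in>A. formula_val \<phi> a) \<and> (\<forall>b\<in>B. \<not> formula_val \<phi> b))"

section \<open>Half-duplex protocols\<close>

datatype edge = Rcv (edge_bit: bool) | Send (edge_bit: bool)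

text \<open>
  A full 4-ary tree is one in which every internal vertex has exactly four children; its leaves
  may lie at different depths.  The first argument of either constructor is the set of inputs
  that labels the vertex.
\<close>

datatype ('i, 'o) hd_tree =
    Leaf (inputs: "'i set") (leaf_output: 'o)
  | Node (inputs: "'i set") (child: "edge \<Rightarrow> ('i, 'o) hd_tree")

primrec tree_depth :: "('i, 'o) hd_tree \<Rightarrow> nat" where
  "tree_depth (Leaf S z) = 0"
| "tree_depth (Node S c) = Suc (Max (range (\<lambda>e. tree_depth (c e))))"

primrec well_labeled :: "('i, 'o) hd_tree \<Rightarrow> bool" where
  "well_labeled (Leaf S z) \<longleftrightarrow> True"
| "well_labeled (Node S c) \<longleftrightarrow>
     inputs (c (Rcv False)) = inputs (c (Rcv True)) \<and>
     S = inputs (c (Rcv False)) \<union> inputs (c (Send False)) \<union> inputs (c (Send True)) \<and>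
     inputs (c (Rcv False)) \<inter> inputs (c (Send False)) = {} \<and>
     inputs (c (Rcv False)) \<inter> inputs (c (Send True)) = {} \<and>
     inputs (c (Send False)) \<inter> inputs (c (Send True)) = {} \<and>
     (\<forall>e. well_labeled (c e))"

text \<open>A vertex is addressed by the labels of the edges on its root path.\<close>

primrec vertex_at :: "('i, 'o) hd_tree \<Rightarrow> edge list \<Rightarrow> ('i, 'o) hd_tree option" where
  "vertex_at t [] = Some t"
| "vertex_at t (e # p) = (case t of Leaf S z \<Rightarrow> None | Node S c \<Rightarrow> vertex_at (c e) p)"

type_synonym ('a, 'b, 'o) hd_protocol = "('a, 'o) hd_tree \<times> ('b, 'o) hd_tree"

fun classical_round :: "edge \<Rightarrow> edge \<Rightarrow> bool" where
  "classical_round (Send \<sigma>) (Rcv \<tau>) \<longleftrightarrow> \<sigma> = \<tau>"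
| "classical_round (Rcv \<sigma>) (Send \<tau>) \<longleftrightarrow> \<sigma> = \<tau>"
| "classical_round _ _ \<longleftrightarrow> False"

fun wasted_round :: "edge \<Rightarrow> edge \<Rightarrow> bool" where
  "wasted_round (Send \<sigma>) (Send \<tau>) \<longleftrightarrow> True"
| "wasted_round _ _ \<longleftrightarrow> False"

fun silent_round :: "edge \<Rightarrow> edge \<Rightarrow> bool" where
  "silent_round (Rcv \<sigma>) (Rcv \<tau>) \<longleftrightarrow> True"
| "silent_round _ _ \<longleftrightarrow> False"

text \<open>
  \<open>run x y u v rs u' v'\<close>: on inputs \<open>x\<close> and \<open>y\<close>, the players can get from the vertices \<open>(u, v)\<close>
  to \<open>(u', v')\<close> by traversing the pairs of edges \<open>rs\<close>, one pair per round.  A player's input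
  determines whether and what it sends.  In a silent round the two received bits are
  unconstrained, which is the adversary's choice.
\<close>

inductive run ::
  "'a \<Rightarrow> 'b \<Rightarrow> ('a, 'o) hd_tree \<Rightarrow> ('b, 'o) hd_tree \<Rightarrow> (edge \<times> edge) list \<Rightarrow>
   ('a, 'o) hd_tree \<Rightarrow> ('b, 'o) hd_tree \<Rightarrow> bool"
  for x :: 'a and y :: 'b where
  run_Nil: "run x y u v [] u v"
| run_Cons: "\<lbrakk>x \<in> inputs (c d); y \<in> inputs (c' e);
              classical_round d e \<or> wasted_round d e \<or> silent_round d e;
              run x y (c d) (c' e) rs u' v'\<rbrakk>
             \<Longrightarrow> run x y (Node S c) (Node T c') ((d, e) # rs) u' v'"

definition half_duplex_protocol ::
  "'a set \<Rightarrow> 'b set \<Rightarrow> ('a, 'b, 'o) hd_protocol \<Rightarrow> bool" where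
  "half_duplex_protocol P Q prot \<longleftrightarrow>
     inputs (fst prot) = P \<and> inputs (snd prot) = Q \<and>
     well_labeled (fst prot) \<and> well_labeled (snd prot) \<and>
     tree_depth (fst prot) = tree_depth (snd prot) \<and>
     (\<forall>x\<in>P. \<forall>y\<in>Q. \<forall>rs u v. run x y (fst prot) (snd prot) rs u v \<longrightarrow>
        (is_Leaf u \<longleftrightarrow> is_Leaf v) \<and> (is_Leaf u \<longrightarrow> leaf_output u = leaf_output v))"

text \<open>Both trees of a protocol have the same depth.\<close>

definition hd_complexity :: "('a, 'b, 'o) hd_protocol \<Rightarrow> nat" where
  "hd_complexity prot = tree_depth (fst prot)"

definition hd_solves ::
  "'a set \<Rightarrow> 'b set \<Rightarrow> ('a \<Rightarrow> 'b \<Rightarrow> 'o \<Rightarrow> bool) \<Rightarrow> ('a, 'b, 'o) hd_protocol \<Rightarrow> bool" where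
  "hd_solves P Q valid prot \<longleftrightarrow>
     (\<forall>x\<in>P. \<forall>y\<in>Q. \<forall>rs u v. run x y (fst prot) (snd prot) rs u v \<and> is_Leaf u \<and> is_Leaf v \<longrightarrow>
        valid x y (leaf_output u) \<and> valid x y (leaf_output v))"

section \<open>The strong composition of KW and MUX\<close>

type_synonym kwmux_input = "(bool list \<Rightarrow> bool) \<times> bool list list"

text \<open>The output \<open>None\<close> stands for the rejecting output (bottom).\<close>

type_synonym kwmux_protocol =
  "(kwmux_input, kwmux_input, (nat \<times> nat) option) hd_protocol"

definition alice_inputs :: "nat \<Rightarrow> nat \<Rightarrow> (bool list \<Rightarrow> bool) \<Rightarrow> kwmux_input set" where
  "alice_inputs m n f = {(g, X). g \<in> bool_funs n \<and> X \<in> matrices m n \<and> f (map g X)}"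

definition bob_inputs :: "nat \<Rightarrow> nat \<Rightarrow> (bool list \<Rightarrow> bool) \<Rightarrow> kwmux_input set" where
  "bob_inputs m n f = {(g, Y). g \<in> bool_funs n \<and> Y \<in> matrices m n \<and> \<not> f (map g Y)}"

definition kwmux_valid ::
  "nat \<Rightarrow> nat \<Rightarrow> kwmux_input \<Rightarrow> kwmux_input \<Rightarrow> (nat \<times> nat) option \<Rightarrow> bool" where
  "kwmux_valid m n x y z =
     (case (x, y) of ((gA, X), (gB, Y)) \<Rightarrow>
        (case z of
           None \<Rightarrow> gA \<noteq> gB
         | Some (i, j) \<Rightarrow> i < m \<and> j < n \<and>
             map gA X ! i \<noteq> map gB Y ! i \<and> X ! i ! j \<noteq> Y ! i ! j))"

definition kwmux_solves :: "nat \<Rightarrow> nat \<Rightarrow> (bool list \<Rightarrow> bool) \<Rightarrow> kwmux_protocol \<Rightarrow> bool" where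
  "kwmux_solves m n f prot \<longleftrightarrow>
     hd_solves (alice_inputs m n f) (bob_inputs m n f) (kwmux_valid m n) prot"

definition partially_half_duplex ::
  "nat \<Rightarrow> nat \<Rightarrow> (bool list \<Rightarrow> bool) \<Rightarrow> kwmux_protocol \<Rightarrow> bool" where
  "partially_half_duplex m n f prot \<longleftrightarrow>
     half_duplex_protocol (alice_inputs m n f) (bob_inputs m n f) prot \<and>
     (\<forall>x\<in>alice_inputs m n f. \<forall>y\<in>bob_inputs m n f. fst x = fst y \<longrightarrow>
        (\<forall>rs u v. run x y (fst prot) (snd prot) rs u v \<longrightarrow>
           (\<forall>(d, e)\<in>set rs. classical_round d e)))"

section \<open>Transcripts\<close>

definition consistent_inputs :: "('i, 'o) hd_tree \<Rightarrow> bool list \<Rightarrow> 'i set" where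
  "consistent_inputs t \<pi> =
     {x. \<exists>p u. map edge_bit p = \<pi> \<and> vertex_at t p = Some u \<and> x \<in> inputs u}"

definition is_transcript :: "('a, 'b, 'o) hd_protocol \<Rightarrow> bool list \<Rightarrow> bool" where
  "is_transcript prot \<pi> \<longleftrightarrow>
     consistent_inputs (fst prot) \<pi> \<noteq> {} \<and> consistent_inputs (snd prot) \<pi> \<noteq> {}"

definition X_of :: "kwmux_protocol \<Rightarrow> bool list \<Rightarrow> (bool list \<Rightarrow> bool) \<Rightarrow> bool list list set" where
  "X_of prot \<pi> g = {X. (g, X) \<in> consistent_inputs (fst prot) \<pi>}"

definition Y_of :: "kwmux_protocol \<Rightarrow> bool list \<Rightarrow> (bool list \<Rightarrow> bool) \<Rightarrow> bool list list set" where
  "Y_of prot \<pi> g = {Y. (g, Y) \<in> consistent_inputs (snd prot) \<pi>}"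

definition X_fiber ::
  "nat \<Rightarrow> nat \<Rightarrow> kwmux_protocol \<Rightarrow> bool list \<Rightarrow> (bool list \<Rightarrow> bool) \<Rightarrow> bool list \<Rightarrow>
   bool list list set" where
  "X_fiber m n prot \<pi> g a = X_of prot \<pi> g \<inter> row_preimage m n g a"

definition Y_fiber ::
  "nat \<Rightarrow> nat \<Rightarrow> kwmux_protocol \<Rightarrow> bool list \<Rightarrow> (bool list \<Rightarrow> bool) \<Rightarrow> bool list \<Rightarrow>
   bool list list set" where
  "Y_fiber m n prot \<pi> g b = Y_of prot \<pi> g \<inter> row_preimage m n g b"

definition A_of ::
  "nat \<Rightarrow> nat \<Rightarrow> (bool list \<Rightarrow> bool) \<Rightarrow> kwmux_protocol \<Rightarrow> bool list \<Rightarrow> (bool list \<Rightarrow> bool) \<Rightarrow>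
   bool list set" where
  "A_of m n f prot \<pi> g = {a \<in> cube m. f a \<and> X_fiber m n prot \<pi> g a \<noteq> {}}"

definition B_of ::
  "nat \<Rightarrow> nat \<Rightarrow> (bool list \<Rightarrow> bool) \<Rightarrow> kwmux_protocol \<Rightarrow> bool list \<Rightarrow> (bool list \<Rightarrow> bool) \<Rightarrow>
   bool list set" where
  "B_of m n f prot \<pi> g = {b \<in> cube m. \<not> f b \<and> Y_fiber m n prot \<pi> g b \<noteq> {}}"

definition V_of ::
  "nat \<Rightarrow> nat \<Rightarrow> (bool list \<Rightarrow> bool) \<Rightarrow> kwmux_protocol \<Rightarrow> bool list \<Rightarrow>
   (bool list \<Rightarrow> bool) set" where
  "V_of m n f prot \<pi> =
     {g \<in> bool_funs n. A_of m n f prot \<pi> g \<noteq> {} \<and> B_of m n f prot \<pi> g \<noteq> {}}"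

section \<open>Liveness\<close>

definition kappa :: real where
  "kappa = 8"

definition alive ::
  "real \<Rightarrow> nat \<Rightarrow> nat \<Rightarrow> (bool list \<Rightarrow> bool) \<Rightarrow> kwmux_protocol \<Rightarrow> bool list \<Rightarrow> bool" where
  "alive \<gamma> m n f prot \<pi> \<longleftrightarrow>
     is_transcript prot \<pi> \<and>
     (\<exists>V. V \<subseteq> V_of m n f prot \<pi> \<and> V \<subseteq> balanced_funs n \<and>
        real (card V) \<ge> 2 powr (- real m) * real (card (balanced_funs n)) \<and>
        (\<forall>g\<in>V. log 2 (real (rect_formula_complexity m (A_of m n f prot \<pi> g) (B_of m n f prot \<pi> g)))
                 \<ge> (1 - \<gamma>) * real m + kappa * log 2 (real m) + kappa) \<and>
        (\<forall>g\<in>V. \<forall>a\<in>A_of m n f prot \<pi> g. \<forall>b\<in>B_of m n f prot \<pi> g.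
           real (card (X_fiber m n prot \<pi> g a))
             \<ge> 2 powr (- \<gamma> * real m + 1) * real (card (row_preimage m n g a)) \<and>
           real (card (Y_fiber m n prot \<pi> g b))
             \<ge> 2 powr (- \<gamma> * real m + 1) * real (card (row_preimage m n g b))))"

end

theory Submission
  imports Defs
begin

text \<open>
  Colour each function \<open>g\<close> of the live set by the continuations \<open>\<rho>\<close> of \<open>\<pi>\<^sub>1\<close> that are transcripts
  for \<open>g\<close> and by those at which Alice speaks; if \<open>c\<close> rounds remain there are \<open>2 ^ O(2 ^ c)\<close> colours.
  When \<open>g\<close> and \<open>h\<close> have the same colour, the execution on \<open>((g, X), (h, Y))\<close> never ends in the
  rejecting output, hence \<open>X\<^sub>i \<noteq> Y\<^sub>i\<close> for some row \<open>i\<close> with \<open>a\<^sub>i \<noteq> b\<^sub>i\<close>.  So it suffices to find, in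
  every colour class that is not too small, two functions with \<open>X\<close> and \<open>Y\<close> that agree on all rows
  where \<open>a\<close> and \<open>b\<close> differ.

  Call a set \<open>X\<close> of words thick with respect to a set \<open>K\<close> of coordinates if it contains a tree that
  branches into more than a \<open>0.58\<close> fraction of the alphabet at the coordinates in \<open>K\<close>.  A set of density
  \<open>\<delta>\<close> is thick for a random \<open>K\<close> (each coordinate chosen with probability \<open>p = 0.42\<close>) with probability
  at least \<open>\<delta>\<close>.  A greedy cover by such random \<open>K\<close> shows that unless some \<open>a\<close> and \<open>b\<close> agree outside a
  common \<open>K\<close> for which both fibers are thick, the rectangle has formula complexity at most
  \<open>O(m\<^sup>2) \<delta>\<^sup>-\<^sup>2 (2 - p\<^sup>2)\<^sup>m\<close>, which contradicts liveness for \<open>\<gamma> = 1 / 24\<close>.  By pigeonhole one \<open>K\<close>, and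
  one restriction of \<open>a\<close> and \<open>b\<close> to the complement of \<open>K\<close>, serve many functions of a class.  Finally,
  all but a \<open>2 ^ -\<Omega>(2 ^ n)\<close> fraction of the functions split every branching set of the trees of a given
  function almost evenly, so two functions of the class split each other's; then the two trees branch
  into sets that meet at every row of \<open>K\<close> where \<open>a\<close> and \<open>b\<close> differ, and have a common path.
\<close>

section \<open>Separating rectangles by formulas\<close>

definition separable :: "nat \<Rightarrow> real \<Rightarrow> bool list set \<Rightarrow> bool list set \<Rightarrow> bool" where
  "separable m r A B \<longleftrightarrow> 0 \<le> r \<and>
     (A = {} \<or> B = {} \<or>
      (\<exists>\<phi>. real (formula_leaves \<phi>) \<le> r \<and> formula_vars \<phi> \<subseteq> {..<m} \<and>
           (\<forall>a\<in>A. formula_val \<phi> a) \<and> (\<forall>b\<in>B. \<not> formula_val \<phi> b)))"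

lemma separable_empty [simp]: "separable m r {} B \<longleftrightarrow> 0 \<le> r" "separable m r A {} \<longleftrightarrow> 0 \<le> r"
  by (auto simp: separable_def)

lemma separable_mono:
  assumes "separable m r A B" "r \<le> s" "A' \<subseteq> A" "B' \<subseteq> B"
  shows "separable m s A' B'"
  using assms unfolding separable_def by (smt (verit, best) subset_empty subset_iff)

text \<open>The disjunction of the two formulas works. If a side is empty there may be no formula to
  combine, and the remaining bound is merely enlarged.\<close>

lemma separable_Un_left:
  assumes "separable m r A B" "separable m s A' B"
  shows "separable m (r + s) (A \<union> A') B"
proof (cases "A = {} \<or> A' = {} \<or> B = {}")
  case True
  with assms show ?thesis
    by (metis le_add_same_cancel1 le_add_same_cancel2 order_refl separable_def separable_mono
        sup_bot_left sup_bot_right)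
next
  case False
  with assms obtain \<phi> \<psi> where
    "real (formula_leaves \<phi>) \<le> r" "formula_vars \<phi> \<subseteq> {..<m}"
    "\<forall>a\<in>A. formula_val \<phi> a" "\<forall>b\<in>B. \<not> formula_val \<phi> b"
    "real (formula_leaves \<psi>) \<le> s" "formula_vars \<psi> \<subseteq> {..<m}"
    "\<forall>a\<in>A'. formula_val \<psi> a" "\<forall>b\<in>B. \<not> formula_val \<psi> b" "0 \<le> r" "0 \<le> s"
    unfolding separable_def by blast
  then show ?thesis
    unfolding separable_def by (intro conjI disjI2 exI[of _ "Or \<phi> \<psi>"]) auto
qed

text \<open>Dual case: the conjunction of the two formulas works.\<close>

lemma separable_Un_right:
  assumes "separable m r A B" "separable m s A B'"
  shows "separable m (r + s) A (B \<union> B')"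
proof (cases "A = {} \<or> B = {} \<or> B' = {}")
  case True
  with assms show ?thesis
    by (metis le_add_same_cancel1 le_add_same_cancel2 order_refl separable_def separable_mono
        sup_bot_left sup_bot_right)
next
  case False
  with assms obtain \<phi> \<psi> where
    "real (formula_leaves \<phi>) \<le> r" "formula_vars \<phi> \<subseteq> {..<m}"
    "\<forall>a\<in>A. formula_val \<phi> a" "\<forall>b\<in>B. \<not> formula_val \<phi> b"
    "real (formula_leaves \<psi>) \<le> s" "formula_vars \<psi> \<subseteq> {..<m}"
    "\<forall>a\<in>A. formula_val \<psi> a" "\<forall>b\<in>B'. \<not> formula_val \<psi> b" "0 \<le> r" "0 \<le> s"
    unfolding separable_def by blast
  then show ?thesis
    unfolding separable_def by (intro conjI disjI2 exI[of _ "And \<phi> \<psi>"]) auto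
qed

lemma separable_literal:
  assumes "i < m" "\<forall>a\<in>A. a ! i = s" "\<forall>b\<in>B. b ! i \<noteq> s"
  shows "separable m 1 A B"
  unfolding separable_def using assms by (intro conjI disjI2 exI[of _ "Lit s i"]) auto

text \<open>Split both sides by one coordinate of \<open>D\<close>: pieces with equal bits fall to
  the induction hypothesis, pieces with opposite bits cost one literal. The cost satisfies r(0) = 0
  and r(d + 1) = 2 (r(d) + 1).\<close>

lemma separable_differ:
  assumes "finite D" "D \<subseteq> {..<m}" "\<forall>a\<in>A. \<forall>b\<in>B. \<exists>i\<in>D. a ! i \<noteq> b ! i"
  shows "separable m (2 * 2 ^ card D - 2) A B"
  using assms
proof (induction D arbitrary: A B rule: finite_induct)
  case empty
  then have "A = {} \<or> B = {}" by blast
  then show ?case by auto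
next
  case (insert i D)
  let ?r = "2 * 2 ^ card D - 2 :: real"
  let ?A = "\<lambda>s. {a \<in> A. a ! i = s}" and ?B = "\<lambda>s. {b \<in> B. b ! i = s}"
  have same: "separable m ?r (?A s) (?B s)" for s
    using insert.prems by (intro insert.IH) fastforce+
  have diff: "separable m 1 (?A s) (?B (\<not> s))" for s
    using insert.prems by (intro separable_literal[of i _ _ s]) auto
  have half: "separable m (?r + 1) (?A s) B" for s
    using separable_Un_right[OF same[of s] diff[of s]]
    by (rule separable_mono) auto
  have "separable m (?r + 1 + (?r + 1)) (?A True \<union> ?A False) B"
    by (intro separable_Un_left half)
  moreover have "?A True \<union> ?A False = A" by auto
  ultimately show ?case
    using insert.hyps by (auto intro: separable_mono)
qed

lemma rect_formula_complexity_le: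
  assumes "separable m r A B"
  shows "real (rect_formula_complexity m A B) \<le> r"
proof (cases "A = {} \<or> B = {}")
  case True
  with assms show ?thesis by (auto simp: rect_formula_complexity_def separable_def)
next
  case False
  with assms obtain \<phi> where \<phi>: "real (formula_leaves \<phi>) \<le> r" "formula_vars \<phi> \<subseteq> {..<m}"
    "\<forall>a\<in>A. formula_val \<phi> a" "\<forall>b\<in>B. \<not> formula_val \<phi> b"
    unfolding separable_def by blast
  then have "rect_formula_complexity m A B \<le> formula_leaves \<phi>"
    using False unfolding rect_formula_complexity_def by (auto intro!: Least_le)
  with \<phi>(1) show ?thesis by linarith
qed

section \<open>Greedy covering\<close>

text \<open>Read \<open>P r A\<close> as: \<open>A\<close> has cost at most \<open>r\<close>. The
  weights cover each element \<delta> times; repeatedly taking a set whose cost per newly covered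
  element is at most average gives a genuine cover and loses a factor 1 + ln |A|.\<close>

lemma greedy_cover:
  fixes P :: "real \<Rightarrow> 'a set \<Rightarrow> bool" and w c :: "'i \<Rightarrow> real"
  assumes P_empty: "P 0 {}"
    and P_Un: "\<And>r s A A'. P r A \<Longrightarrow> P s A' \<Longrightarrow> P (r + s) (A \<union> A')"
    and P_mono: "\<And>r s A A'. P r A \<Longrightarrow> r \<le> s \<Longrightarrow> A' \<subseteq> A \<Longrightarrow> P s A'"
    and fin: "finite \<Omega>" and w: "\<And>i. i \<in> \<Omega> \<Longrightarrow> 0 \<le> w i" and c: "\<And>i. i \<in> \<Omega> \<Longrightarrow> 0 \<le> c i"
    and "0 < \<delta>"
    and cov: "\<And>a. a \<in> A \<Longrightarrow> \<delta> \<le> (\<Sum>i | i \<in> \<Omega> \<and> a \<in> U i. w i)"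
    and P: "\<And>i. i \<in> \<Omega> \<Longrightarrow> P (c i) (U i)"
    and "finite A" "A \<noteq> {}"
  shows "P ((\<Sum>i\<in>\<Omega>. w i * c i) / \<delta> * (1 + ln (card A))) A"
  using \<open>finite A\<close> \<open>A \<noteq> {}\<close> cov
proof (induction A rule: finite_psubset_induct)
  case (psubset A)
  define E where "E = (\<Sum>i\<in>\<Omega>. w i * c i) / \<delta>"
  define s where "s = real (card A)"
  have s: "s \<ge> 1" using psubset.hyps psubset.prems(1)
    by (simp add: s_def Suc_leI card_gt_0_iff)
  have E0: "E \<ge> 0" unfolding E_def using w c \<open>0 < \<delta>\<close> by (auto intro!: divide_nonneg_pos sum_nonneg)
  have "\<delta> * s \<le> (\<Sum>a\<in>A. \<Sum>i | i \<in> \<Omega> \<and> a \<in> U i. w i)"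
    using sum_mono[of A "\<lambda>_. \<delta>", OF psubset.prems(2)] by (simp add: s_def mult.commute)
  also have "\<dots> = (\<Sum>a\<in>A. \<Sum>i\<in>\<Omega>. if a \<in> U i then w i else 0)"
    using fin by (simp add: sum.inter_filter)
  also have "\<dots> = (\<Sum>i\<in>\<Omega>. \<Sum>a\<in>A. if a \<in> U i then w i else 0)"
    by (rule sum.swap)
  also have "\<dots> = (\<Sum>i\<in>\<Omega>. w i * card (A \<inter> U i))"
    using psubset.hyps by (simp add: sum.If_cases mult.commute)
  finally have tot: "\<delta> * s \<le> (\<Sum>i\<in>\<Omega>. w i * card (A \<inter> U i))" .
  \<comment> \<open>Averaging: otherwise every \<open>U i\<close> that meets \<open>A\<close> costs
    more than \<open>E / s\<close> per element covered, and the weighted sum contradicts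
    \<open>tot\<close>. Meeting \<open>A\<close> makes the remainder a proper subset.\<close>
  have "\<exists>i\<in>\<Omega>. c i * s \<le> E * card (A \<inter> U i) \<and> A \<inter> U i \<noteq> {}"
  proof (rule ccontr)
    assume neg: "\<not> ?thesis"
    have *: "w i * (E * card (A \<inter> U i)) \<le> w i * (c i * s)" if "i \<in> \<Omega>" for i
      using neg that c[OF that] w[OF that] s
      by (cases "A \<inter> U i = {}") (force intro!: mult_left_mono)+
    have **: "w i * (E * card (A \<inter> U i)) < w i * (c i * s)"
      if "i \<in> \<Omega>" "w i \<noteq> 0" "A \<inter> U i \<noteq> {}" for i
      using neg that w[OF that(1)] by (intro mult_strict_left_mono) force+
    obtain i where i: "i \<in> \<Omega>" "w i * card (A \<inter> U i) \<noteq> 0"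
      using tot \<open>0 < \<delta>\<close> s by (smt (verit, best) mult_pos_pos sum.neutral)
    have "(\<Sum>i\<in>\<Omega>. w i * (E * card (A \<inter> U i))) < (\<Sum>i\<in>\<Omega>. w i * (c i * s))"
      using i fin by (intro sum_strict_mono_ex1) (auto intro!: * ** bexI[of _ i])
    also have "\<dots> = E * \<delta> * s"
      using \<open>0 < \<delta>\<close> by (simp add: E_def) (simp add: sum_distrib_right mult.assoc)
    also have "(\<Sum>i\<in>\<Omega>. w i * (E * card (A \<inter> U i))) = E * (\<Sum>i\<in>\<Omega>. w i * card (A \<inter> U i))"
      by (simp add: sum_distrib_left mult.left_commute)
    finally show False using tot E0 by (smt (verit, best) mult.assoc mult_left_mono)
  qed
  then obtain i where i: "i \<in> \<Omega>" "c i * s \<le> E * card (A \<inter> U i)" "A \<inter> U i \<noteq> {}" by blast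
  define r where "r = real (card (A \<inter> U i))"
  have ci: "c i \<le> E * (r / s)" using i(2) s by (simp add: r_def field_simps)
  show ?case
  proof (cases "A \<subseteq> U i")
    case True
    then have "r = s" by (simp add: r_def s_def Int_absorb2)
    then have "c i \<le> E * (1 + ln s)"
      using ci s E0 by (smt (verit, ccfv_SIG) divide_self ln_ge_zero mult_left_mono)
    from P_mono[OF P[OF i(1)] this True] show ?thesis unfolding E_def s_def .
  next
    case False
    have sr: "real (card (A - U i)) = s - r"
      using psubset.hyps by (simp add: r_def s_def card_Diff_subset_Int of_nat_diff card_mono)
    have pos: "s - r > 0"
      using sr False psubset.hyps by (metis Diff_eq_empty_iff card_gt_0_iff finite_Diff of_nat_0_less_iff)
    have "P (E * (1 + ln (s - r))) (A - U i)"
      unfolding E_def sr[symmetric] using False i(3) psubset.prems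
      by (intro psubset.IH) auto
    from P_Un[OF P[OF i(1)] this] have "P (c i + E * (1 + ln (s - r))) (U i \<union> (A - U i))" .
    \<comment> \<open>Covering \<open>r\<close> of \<open>s\<close> elements is charged
      \<open>E * (r / s)\<close>; the drop of the logarithm from \<open>s\<close> to
      \<open>s - r\<close> pays for it.\<close>
    moreover have "ln (s - r) - ln s \<le> (s - r) / s - 1"
      using ln_le_minus_one[of "(s - r) / s"] pos s by (simp add: ln_div)
    then have "r / s + (1 + ln (s - r)) \<le> 1 + ln s" using s by (simp add: diff_divide_distrib)
    then have "c i + E * (1 + ln (s - r)) \<le> E * (1 + ln s)"
      using ci E0 by (smt (verit, ccfv_SIG) distrib_left mult_left_mono)
    ultimately have "P (E * (1 + ln s)) A" by (rule P_mono) auto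
    then show ?thesis unfolding E_def s_def .
  qed
qed

section \<open>Random masks and thick sets\<close>

lemma cube_0 [simp]: "cube 0 = {[]}"
  by (auto simp: cube_def)

lemma cube_Suc: "cube (Suc m) = Cons True ` cube m \<union> Cons False ` cube m"
  by (auto simp: cube_def length_Suc_conv image_iff)

lemma cube_altdef: "cube m = {xs. set xs \<subseteq> UNIV \<and> length xs = m}"
  by (auto simp: cube_def)

lemma finite_cube [simp, intro]: "finite (cube m)"
  unfolding cube_altdef by (rule finite_lists_length_eq) simp

lemma card_cube: "card (cube m) = 2 ^ m"
  unfolding cube_altdef by (subst card_lists_length_eq) auto

lemma sum_cube_Suc: "(\<Sum>K\<in>cube (Suc m). h K) = (\<Sum>K\<in>cube m. h (True # K)) + (\<Sum>K\<in>cube m. h (False # K))"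
  unfolding cube_Suc by (subst sum.union_disjoint) (auto simp: sum.reindex)

definition weight :: "real \<Rightarrow> bool list \<Rightarrow> real" where
  "weight p K = prod_list (map (\<lambda>k. if k then p else 1 - p) K)"

lemma weight_simps [simp]:
  "weight p [] = 1" "weight p (True # K) = p * weight p K" "weight p (False # K) = (1 - p) * weight p K"
  by (simp_all add: weight_def)

lemma weight_nonneg: "0 \<le> p \<Longrightarrow> p \<le> 1 \<Longrightarrow> 0 \<le> weight p K"
  unfolding weight_def by (induction K) auto

definition meet :: "bool list \<Rightarrow> bool list \<Rightarrow> bool list" where
  "meet = map2 (\<and>)"

lemma length_meet [simp]: "length (meet I J) = min (length I) (length J)"
  by (simp add: meet_def)

lemma meet_Nil [simp]: "meet [] J = []" and meet_Cons [simp]: "meet (a # I) (b # J) = (a \<and> b) # meet I J"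
  by (simp_all add: meet_def)

lemma meet_commute: "meet I J = meet J I"
  unfolding meet_def by (induction I J rule: list_induct2') auto

text \<open>An expectation over two independent random masks. Coordinates are independent; each
  contributes the factor 1 if both masks mark it, with probability p^2, and 2 otherwise, hence 2 -
  p^2 on average.\<close>

lemma sum_weight_meet:
  "(\<Sum>I\<in>cube m. weight p I * (\<Sum>J\<in>cube m. weight p J * 2 ^ length (filter Not (meet I J))))
     = (2 - p\<^sup>2) ^ m"
proof (induction m)
  case (Suc m)
  define s where "s I = (\<Sum>J\<in>cube m. weight p J * 2 ^ length (filter Not (meet I J)))" for I
  have "(\<Sum>J\<in>cube (Suc m). weight p J * 2 ^ length (filter Not (meet (a # I) J)))
      = (if a then 2 - p else 2) * s I" for a I
    unfolding sum_cube_Suc s_def sum_distrib_left sum.distrib[symmetric]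
    by (intro sum.cong refl) (simp add: algebra_simps)
  then have "(\<Sum>I\<in>cube (Suc m). weight p I *
        (\<Sum>J\<in>cube (Suc m). weight p J * 2 ^ length (filter Not (meet I J))))
      = (\<Sum>I\<in>cube m. weight p (True # I) * ((2 - p) * s I)) +
        (\<Sum>I\<in>cube m. weight p (False # I) * (2 * s I))"
    unfolding sum_cube_Suc[where h = "\<lambda>I. weight p I *
        (\<Sum>J\<in>cube (Suc m). weight p J * 2 ^ length (filter Not (meet I J)))"] by (simp add: mult_ac)
  also have "\<dots> = (2 - p\<^sup>2) * (\<Sum>I\<in>cube m. weight p I * s I)"
    unfolding sum.distrib[symmetric] sum_distrib_left
    by (intro sum.cong refl) (simp add: algebra_simps power2_eq_square)
  finally show ?case using Suc by (simp add: s_def)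
qed simp

section \<open>Thick sets of words\<close>

primrec thick :: "real \<Rightarrow> bool list \<Rightarrow> 'a list set \<Rightarrow> bool" where
  "thick t [] X \<longleftrightarrow> [] \<in> X"
| "thick t (k # K) X \<longleftrightarrow>
     (if k then t < real (card {\<sigma>. thick t K {xs. \<sigma> # xs \<in> X}})
      else \<exists>\<sigma>. thick t K {xs. \<sigma> # xs \<in> X})"

lemma thick_Cons_imp_ex:
  assumes "thick t (k # K) X" "0 \<le> t"
  shows "\<exists>\<sigma>. thick t K {xs. \<sigma> # xs \<in> X}"
proof (cases k)
  case True
  with assms have "0 < card {\<sigma>. thick t K {xs. \<sigma> # xs \<in> X}}" by simp
  then have "{\<sigma>. thick t K {xs. \<sigma> # xs \<in> X}} \<noteq> {}" by (metis card.empty less_numeral_extra(3))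
  then show ?thesis by simp
next
  case False
  with assms show ?thesis by simp
qed

lemma thick_nonempty:
  assumes "thick t K X" "0 \<le> t"
  shows "X \<noteq> {}"
  using assms(1)
proof (induction K arbitrary: X)
  case (Cons k K)
  obtain \<sigma> where "thick t K {xs. \<sigma> # xs \<in> X}"
    using thick_Cons_imp_ex[OF Cons.prems assms(2)] by blast
  from Cons.IH[OF this] show ?case by blast
qed auto

lemma thick_letters_subset:
  assumes "0 \<le> t"
  shows "{\<sigma>. thick t K {xs. \<sigma> # xs \<in> X}} \<subseteq> hd ` X"
proof
  fix \<sigma> assume "\<sigma> \<in> {\<sigma>. thick t K {xs. \<sigma> # xs \<in> X}}"
  then have "{xs. \<sigma> # xs \<in> X} \<noteq> {}" using thick_nonempty assms by blast
  then obtain xs where "\<sigma> # xs \<in> X" by blast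
  then show "\<sigma> \<in> hd ` X" by (intro image_eqI[of _ _ "\<sigma> # xs"]) simp_all
qed

lemma finite_residual: "finite X \<Longrightarrow> finite {xs. \<sigma> # xs \<in> X}"
  using finite_vimageI[of X "Cons \<sigma>"] by (simp add: vimage_def)

text \<open>Unmarking a coordinate asks for less: more than \<open>t\<close> \<ge> 0 children
  include at least one. Finiteness of \<open>X\<close> makes \<open>card\<close> monotone. The lemma
  brings two masks to a common one.\<close>

lemma thick_meet:
  assumes "thick t K X" "length L = length K" "0 \<le> t" "finite X"
  shows "thick t (meet K L) X"
  using assms(2,1,3,4)
proof (induction L K arbitrary: X rule: list_induct2)
  case (Cons l L k K)
  let ?N = "\<lambda>K. {\<sigma>. thick t K {xs. \<sigma> # xs \<in> X}}"
  have sub: "?N K \<subseteq> ?N (meet K L)" using Cons.IH Cons.prems(2) finite_residual[OF Cons.prems(3)] by blast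
  show ?case
  proof (cases k)
    case True
    with Cons.prems have big: "t < card (?N K)" by simp
    then have "?N K \<noteq> {}" using Cons.prems(2) by (metis card.empty linorder_not_less of_nat_0)
    with sub have ne: "?N (meet K L) \<noteq> {}" by blast
    show ?thesis
    proof (cases l)
      case True
      have "card (?N K) \<le> card (?N (meet K L))"
        using finite_subset[OF thick_letters_subset finite_imageI] Cons.prems sub
        by (intro card_mono) blast+
      with \<open>k\<close> True big show ?thesis by simp
    qed (use ne \<open>k\<close> in auto)
  next
    case False
    with Cons.prems sub show ?thesis by auto
  qed
qed simp

lemma sum_Collect_eq_of_bool:
  fixes w :: "'a \<Rightarrow> real"
  assumes "finite A"
  shows "(\<Sum>x | x \<in> A \<and> P x. w x) = (\<Sum>x\<in>A. w x * of_bool (P x))"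
  using assms by (intro sum.mono_neutral_cong_left) auto

text \<open>The random mask marks each coordinate with probability 1 - \<tau>. Split
  \<open>X\<close> by its first letter and apply the induction hypothesis to each residual; for a
  fixed tail of the mask, the number of letters with thick residual is then compared with the two
  values of the first mask bit.\<close>

lemma density_le_thick_weight:
  fixes X :: "'a list set"
  assumes "X \<subseteq> listset Ss" "\<And>S. S \<in> set Ss \<Longrightarrow> finite S \<and> card S = q" "0 \<le> \<tau>" "\<tau> \<le> 1"
  shows "real (card X) \<le> real q ^ length Ss *
           (\<Sum>K | K \<in> cube (length Ss) \<and> thick (\<tau> * q) K X. weight (1 - \<tau>) K)"
  using assms(1,2)
proof (induction Ss arbitrary: X)
  case Nil
  then consider "X = {}" | "X = {[]}" by auto
  then have "card X = of_bool ([] \<in> X)" by cases auto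
  then show ?case by (subst sum_Collect_eq_of_bool) auto
next
  case (Cons S Ss)
  define d where "d \<sigma> = {xs. \<sigma> # xs \<in> X}" for \<sigma>
  let ?m = "length Ss" and ?t = "\<tau> * real q"
  let ?th = "\<lambda>K X. of_bool (thick ?t K X) :: real"
  have S: "finite S" "card S = q" using Cons.prems(2) by auto
  have d: "d \<sigma> \<subseteq> listset Ss" for \<sigma>
    using Cons.prems(1) by (auto simp: d_def set_Cons_def)
  have d_empty: "d \<sigma> = {}" if "\<sigma> \<notin> S" for \<sigma>
    using Cons.prems(1) that by (auto simp: d_def set_Cons_def)
  have "X = (\<Union>\<sigma>\<in>S. Cons \<sigma> ` d \<sigma>)"
    using Cons.prems(1) by (fastforce simp: d_def set_Cons_def)
  then have "card X \<le> (\<Sum>\<sigma>\<in>S. card (Cons \<sigma> ` d \<sigma>))"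
    using card_UN_le[OF S(1)] by metis
  also have "\<dots> = (\<Sum>\<sigma>\<in>S. card (d \<sigma>))" by (simp add: card_image)
  finally have "real (card X) \<le> (\<Sum>\<sigma>\<in>S. real (card (d \<sigma>)))"
    by (metis of_nat_le_iff of_nat_sum)
  also have "\<dots> \<le> (\<Sum>\<sigma>\<in>S. real q ^ ?m * (\<Sum>K\<in>cube ?m. weight (1 - \<tau>) K * ?th K (d \<sigma>)))"
    using Cons.IH[OF d] Cons.prems(2)
    by (intro sum_mono) (simp add: sum_Collect_eq_of_bool)
  also have "\<dots> = real q ^ ?m * (\<Sum>K\<in>cube ?m. weight (1 - \<tau>) K * (\<Sum>\<sigma>\<in>S. ?th K (d \<sigma>)))"
    unfolding sum_distrib_left by (subst sum.swap) simp
  also have "\<dots> \<le> real q ^ ?m * (\<Sum>K\<in>cube ?m. weight (1 - \<tau>) K *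
       (q * (\<tau> * ?th (False # K) X + (1 - \<tau>) * ?th (True # K) X)))"
  proof (intro mult_left_mono sum_mono)
    fix K
    let ?N = "{\<sigma>. thick ?t K (d \<sigma>)}"
    have N: "?N \<subseteq> S" using d_empty thick_nonempty[of ?t K] assms(3) by (metis (mono_tags, lifting)
          mem_Collect_eq mult_nonneg_nonneg of_nat_0_le_iff subsetI)
    have "(\<Sum>\<sigma>\<in>S. ?th K (d \<sigma>)) = card ?N"
    proof -
      have "{\<sigma> \<in> S. thick ?t K (d \<sigma>)} = ?N" using N by blast
      then show ?thesis
        using sum_Collect_eq_of_bool[OF S(1), where w = "\<lambda>_. 1" and P = "\<lambda>\<sigma>. thick ?t K (d \<sigma>)"]
        by simp
    qed
    \<comment> \<open>At most \<tau> q letters, but at least one, are paid for by the unmarked case,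
      of probability \<tau>; a larger number, still at most q, by both cases together.\<close>
    also have "\<dots> \<le> q * (\<tau> * of_bool (card ?N \<noteq> 0) + (1 - \<tau>) * of_bool (?t < card ?N))"
    proof -
      have "card ?N \<le> q" using card_mono[OF S(1) N] S(2) by simp
      then show ?thesis
        using assms(3,4) by (cases "card ?N = 0"; cases "?t < card ?N") (simp_all add: mult.commute)
    qed
    also have "card ?N \<noteq> 0 \<longleftrightarrow> thick ?t (False # K) X"
      using finite_subset[OF N S(1)] by (auto simp: d_def)
    also have "?t < card ?N \<longleftrightarrow> thick ?t (True # K) X" by (simp add: d_def)
    finally show "(\<Sum>\<sigma>\<in>S. ?th K (d \<sigma>)) \<le>
        q * (\<tau> * ?th (False # K) X + (1 - \<tau>) * ?th (True # K) X)" .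
  qed (use assms weight_nonneg in auto)
  also have "\<dots> = real q ^ length (S # Ss) * (\<Sum>K\<in>cube (Suc ?m). weight (1 - \<tau>) K * ?th K X)"
    unfolding sum_cube_Suc sum.distrib[symmetric] sum_distrib_left weight_simps
    by (intro sum.cong refl) (simp add: algebra_simps del: thick.simps)
  also have "(\<Sum>K\<in>cube (Suc ?m). weight (1 - \<tau>) K * ?th K X) =
     (\<Sum>K | K \<in> cube (length (S # Ss)) \<and> thick ?t K X. weight (1 - \<tau>) K)"
    by (simp add: sum_Collect_eq_of_bool del: thick.simps)
  finally show ?case .
qed


section \<open>Covering a rectangle by random masks\<close>

lemma ln_card_cube_subset_le:
  assumes "A \<subseteq> cube m" "A \<noteq> {}"
  shows "ln (card A) \<le> m"
proof -
  have "card A \<le> 2 ^ m" using card_mono[OF finite_cube assms(1)] by (simp add: card_cube)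
  moreover have "card A > 0" using assms finite_subset by (metis card_gt_0_iff finite_cube)
  ultimately have "ln (card A) \<le> ln (2 ^ m)" by (subst ln_le_cancel_iff) (simp_all flip: of_nat_le_iff)
  also have "\<dots> = m * ln 2" by (simp add: ln_realpow)
  also have "\<dots> \<le> m" using ln_le_minus_one[of 2] by (intro mult_left_le) auto
  finally show ?thesis .
qed

text \<open>
  A random mask \<open>I\<close> serves any given \<open>a\<close> with probability at least \<open>\<delta>\<close>, and a random \<open>J\<close> any
  given \<open>b\<close>.  So \<open>A\<close>, and then \<open>B\<close>, can be covered greedily, and the pieces are separable by
  their coordinates outside \<open>meet I J\<close>.
\<close>

lemma separable_by_random_masks:
  assumes A: "A \<subseteq> cube m" and B: "B \<subseteq> cube m" and "0 < \<delta>" and p: "0 \<le> p" "p \<le> 1"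
    and F: "\<And>a. a \<in> A \<Longrightarrow> \<delta> \<le> (\<Sum>K | K \<in> cube m \<and> F a K. weight p K)"
    and G: "\<And>b. b \<in> B \<Longrightarrow> \<delta> \<le> (\<Sum>K | K \<in> cube m \<and> G b K. weight p K)"
    and differ: "\<And>a b I J. a \<in> A \<Longrightarrow> b \<in> B \<Longrightarrow> I \<in> cube m \<Longrightarrow> J \<in> cube m \<Longrightarrow> F a I \<Longrightarrow> G b J \<Longrightarrow>
                   \<exists>i<m. \<not> meet I J ! i \<and> a ! i \<noteq> b ! i"
  shows "separable m (2 * ((1 + real m) / \<delta>)\<^sup>2 * (2 - p\<^sup>2) ^ m) A B"
proof (cases "A = {} \<or> B = {}")
  case True
  have "p\<^sup>2 \<le> 1" using p by (simp add: power_le_one)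
  then show ?thesis using True \<open>0 < \<delta>\<close> by auto
next
  case False
  define U where "U I = {a \<in> A. F a I}" for I
  define W where "W J = {b \<in> B. G b J}" for J
  define s where "s I = (\<Sum>J\<in>cube m. weight p J * 2 ^ length (filter Not (meet I J)))" for I
  note finite = finite_subset[OF A finite_cube] finite_subset[OF B finite_cube]
  note pos = weight_nonneg[OF p]
  have s0: "0 \<le> s I" for I unfolding s_def using pos by (intro sum_nonneg) auto
  have piece: "separable m (2 * 2 ^ length (filter Not (meet I J))) (U I) (W J)"
    if "I \<in> cube m" "J \<in> cube m" for I J
  proof -
    let ?D = "{i. i < m \<and> \<not> meet I J ! i}"
    have "separable m (2 * 2 ^ card ?D - 2) (U I) (W J)"
      using differ[OF _ _ that] by (intro separable_differ) (auto simp: U_def W_def)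
    moreover have "card ?D = length (filter Not (meet I J))"
      using that by (simp add: length_filter_conv_card cube_def cong: conj_cong)
    ultimately have "separable m (2 * 2 ^ length (filter Not (meet I J)) - 2) (U I) (W J)" by simp
    then show ?thesis by (rule separable_mono) auto
  qed
  \<comment> \<open>\<open>B\<close> is covered for a fixed mask \<open>I\<close> first. The cost is
    linear in \<open>s I\<close>, so covering \<open>A\<close> afterwards averages it over
    \<open>I\<close>.\<close>
  have cover_B: "separable m (2 * (1 + real m) / \<delta> * s I) (U I) B" if I: "I \<in> cube m" for I
  proof -
    have "separable m ((\<Sum>J\<in>cube m. weight p J * (2 * 2 ^ length (filter Not (meet I J)))) / \<delta>
        * (1 + ln (card B))) (U I) B"
    proof (rule greedy_cover[where P = "\<lambda>r. separable m r (U I)" and U = W])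
      show "\<delta> \<le> (\<Sum>J | J \<in> cube m \<and> b \<in> W J. weight p J)" if "b \<in> B" for b
        using G[OF that] that by (simp add: W_def)
      show "separable m (r + r') (U I) (X \<union> X')"
        if "separable m r (U I) X" "separable m r' (U I) X'" for r r' X X'
        using that by (rule separable_Un_right)
      show "separable m r' (U I) X'" if "separable m r (U I) X" "r \<le> r'" "X' \<subseteq> X" for r r' X X'
        by (rule separable_mono[OF that(1,2) order_refl that(3)])
    qed (use False \<open>0 < \<delta>\<close> pos finite piece[OF I] in simp_all)
    also have "(\<Sum>J\<in>cube m. weight p J * (2 * 2 ^ length (filter Not (meet I J)))) = 2 * s I"
      by (simp add: s_def sum_distrib_left mult.left_commute)
    finally show ?thesis
    proof (rule separable_mono)
      have "2 * s I / \<delta> * (1 + ln (card B)) \<le> 2 * s I / \<delta> * (1 + real m)"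
        using ln_card_cube_subset_le[OF B] False s0[of I] \<open>0 < \<delta>\<close> by (intro mult_left_mono) auto
      then show "2 * s I / \<delta> * (1 + ln (card B)) \<le> 2 * (1 + real m) / \<delta> * s I" by (simp add: mult_ac)
    qed auto
  qed
  have "separable m ((\<Sum>I\<in>cube m. weight p I * (2 * (1 + real m) / \<delta> * s I)) / \<delta> * (1 + ln (card A))) A B"
  proof (rule greedy_cover[where P = "\<lambda>r A. separable m r A B" and U = U])
    show "\<delta> \<le> (\<Sum>I | I \<in> cube m \<and> a \<in> U I. weight p I)" if "a \<in> A" for a
      using F[OF that] that by (simp add: U_def)
    show "0 \<le> 2 * (1 + real m) / \<delta> * s I" for I
      using s0 \<open>0 < \<delta>\<close> by simp
    show "separable m (r + r') (X \<union> X') B"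
      if "separable m r X B" "separable m r' X' B" for r r' X X'
      using that by (rule separable_Un_left)
    show "separable m r' X' B" if "separable m r X B" "r \<le> r'" "X' \<subseteq> X" for r r' X X'
      by (rule separable_mono[OF that(1,2,3) order_refl])
  qed (use False \<open>0 < \<delta>\<close> pos finite cover_B in simp_all)
  also have "(\<Sum>I\<in>cube m. weight p I * (2 * (1 + real m) / \<delta> * s I)) = 2 * (1 + real m) / \<delta> * (\<Sum>I\<in>cube m. weight p I * s I)"
    by (simp add: sum_distrib_left mult.left_commute)
  also have "(\<Sum>I\<in>cube m. weight p I * s I) = (2 - p\<^sup>2) ^ m"
    unfolding s_def by (rule sum_weight_meet)
  finally show ?thesis
  proof (rule separable_mono)
    have "p\<^sup>2 \<le> 1" using p by (simp add: power_le_one)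
    then have "2 * (1 + real m) / \<delta> * (2 - p\<^sup>2) ^ m / \<delta> * (1 + ln (card A)) \<le>
        2 * (1 + real m) / \<delta> * (2 - p\<^sup>2) ^ m / \<delta> * (1 + real m)"
      using ln_card_cube_subset_le[OF A] False \<open>0 < \<delta>\<close> by (intro mult_left_mono) auto
    also have "\<dots> = 2 * ((1 + real m) / \<delta>)\<^sup>2 * (2 - p\<^sup>2) ^ m"
      by (simp add: power2_eq_square)
    finally show "2 * (1 + real m) / \<delta> * (2 - p\<^sup>2) ^ m / \<delta> * (1 + ln (card A)) \<le>
        2 * ((1 + real m) / \<delta>)\<^sup>2 * (2 - p\<^sup>2) ^ m" .
  qed auto
qed

text \<open>All coordinates together tell disjoint sets apart. This crude bound serves to exclude
  \<open>m\<close> \<le> 1.\<close>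

lemma rect_formula_complexity_le_cube:
  assumes "A \<subseteq> cube m" "B \<subseteq> cube m" "A \<inter> B = {}"
  shows "real (rect_formula_complexity m A B) \<le> 2 * 2 ^ m - 2"
proof -
  have "separable m (2 * 2 ^ card {..<m} - 2) A B"
  proof (intro separable_differ ballI)
    fix a b assume "a \<in> A" "b \<in> B"
    then have "a \<noteq> b" "length a = m" "length b = m" using assms by (auto simp: cube_def)
    then show "\<exists>i\<in>{..<m}. a ! i \<noteq> b ! i" by (auto simp: list_eq_iff_nth_eq)
  qed auto
  from rect_formula_complexity_le[OF this] show ?thesis by simp
qed

section \<open>Functions that split test sets evenly\<close>

lemma finite_bool_funs [simp, intro]: "finite (bool_funs n)"
  unfolding bool_funs_def by (intro finite_PiE) auto

text \<open>The slack is a fraction of the whole cube rather than of \<open>W\<close>, so small sets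
  have no deviating functions.\<close>

definition deviating :: "nat \<Rightarrow> real \<Rightarrow> bool list set \<Rightarrow> (bool list \<Rightarrow> bool) set" where
  "deviating n \<epsilon> W =
     {g \<in> bool_funs n. \<exists>s. real (card {x \<in> W. g x = s}) < card W / 2 - \<epsilon> * 2 ^ n}"

text \<open>Divided by 2 exp(-l/2), this is cosh(l/2) \<le> exp(l^2/4). The quadratic Taylor
  polynomials at l and -l have product 1 + l^4/4, so exp l \<ge> 1 + l + l^2/2 yields exp(-l) \<le>
  1 - l + l^2/2.\<close>

lemma one_plus_exp_minus_le:
  assumes "0 \<le> (l :: real)"
  shows "1 + exp (- l) \<le> 2 * exp (l\<^sup>2 / 4 - l / 2)"
proof -
  have "(1 + l + l\<^sup>2 / 2) * (1 - l + l\<^sup>2 / 2) = 1 + (l\<^sup>2)\<^sup>2 / 4"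
    by (simp add: field_simps power2_eq_square)
  then have "1 \<le> (1 + l + l\<^sup>2 / 2) * (1 - l + l\<^sup>2 / 2)" by simp
  also have "\<dots> \<le> exp l * (1 - l + l\<^sup>2 / 2)"
  proof (rule mult_right_mono)
    show "0 \<le> 1 - l + l\<^sup>2 / 2"
      using zero_le_power2[of "1 - l"] by (simp add: power2_diff)
  qed (rule exp_lower_Taylor_quadratic[OF assms])
  finally have "exp (- l) * 1 \<le> exp (- l) * (exp l * (1 - l + l\<^sup>2 / 2))"
    by (intro mult_left_mono) simp_all
  then have "exp (- l) \<le> 1 - l + l\<^sup>2 / 2"
    by (simp add: mult.assoc[symmetric] exp_add[symmetric])
  then have "1 + exp (- l) \<le> 2 * (1 + (l\<^sup>2 / 4 - l / 2))" by simp
  also have "\<dots> \<le> 2 * exp (l\<^sup>2 / 4 - l / 2)"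
    by (intro mult_left_mono exp_ge_add_one_self) simp
  finally show ?thesis .
qed

text \<open>A Chernoff bound by counting: the exponential moment, summed over all functions, is a
  product over the points of the cube.\<close>

lemma card_one_sided_deviation_le:
  assumes W: "W \<subseteq> cube n" and "0 \<le> \<epsilon>"
  shows "card {g \<in> bool_funs n. real (card {x \<in> W. g x = s}) < card W / 2 - \<epsilon> * 2 ^ n}
           \<le> 2 ^ 2 ^ n * exp (- \<epsilon>\<^sup>2 * 2 ^ n)" (is "real (card ?D) \<le> _")
proof -
  \<comment> \<open>This value minimises l^2/4 - l \<epsilon>, the final exponent per point of the
    cube.\<close>
  define l where "l = 2 * \<epsilon>"
  define e where "e = exp (- l)"
  have l: "0 \<le> l" using assms by (simp add: l_def)
  have finW: "finite W" using W finite_subset by blast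
  have cW: "real (card W) \<le> 2 ^ n"
    using of_nat_mono[OF card_mono[OF finite_cube W], where 'a = real] by (simp add: card_cube)
  let ?h = "\<lambda>x b. if x \<in> W \<and> b = s then e else 1"
  have h: "(\<Prod>x\<in>cube n. ?h x (g x)) = exp (- l * card {x \<in> W. g x = s})" for g
  proof -
    have "(\<Prod>x\<in>cube n. ?h x (g x)) = (\<Prod>x | x \<in> cube n \<and> x \<in> W \<and> g x = s. e)"
      by (rule prod.inter_filter[symmetric]) simp
    also have "{x. x \<in> cube n \<and> x \<in> W \<and> g x = s} = {x \<in> W. g x = s}" using W by auto
    finally show ?thesis by (simp add: e_def exp_of_nat_mult[symmetric] mult.commute)
  qed
  have "card ?D * exp (- l * (card W / 2 - \<epsilon> * 2 ^ n)) = (\<Sum>g\<in>?D. exp (- l * (card W / 2 - \<epsilon> * 2 ^ n)))"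
    by simp
  also have "\<dots> \<le> (\<Sum>g\<in>?D. exp (- l * card {x \<in> W. g x = s}))"
    using l by (intro sum_mono) (auto intro!: mult_left_mono)
  also have "\<dots> \<le> (\<Sum>g\<in>bool_funs n. exp (- l * card {x \<in> W. g x = s}))"
    by (intro sum_mono2) auto
  also have "\<dots> = (\<Prod>x\<in>cube n. \<Sum>b\<in>UNIV. ?h x b)"
    unfolding bool_funs_def h[symmetric] by (rule prod_sum_PiE[symmetric]) auto
  also have "\<dots> = (\<Prod>x\<in>cube n. if x \<in> W then 1 + e else 2)"
    by (intro prod.cong refl) (cases s; simp add: UNIV_bool)
  also have "\<dots> \<le> (\<Prod>x\<in>cube n. 2 * (if x \<in> W then exp (l\<^sup>2 / 4 - l / 2) else 1))"
    using one_plus_exp_minus_le[OF l] by (intro prod_mono) (auto simp: e_def add_nonneg_nonneg)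
  also have "\<dots> = 2 ^ 2 ^ n * (\<Prod>x | x \<in> cube n \<and> x \<in> W. exp (l\<^sup>2 / 4 - l / 2))"
    unfolding prod.distrib by (subst prod.inter_filter) (simp_all add: card_cube)
  also have "{x. x \<in> cube n \<and> x \<in> W} = W" using W by auto
  also have "(\<Prod>x\<in>W. exp (l\<^sup>2 / 4 - l / 2)) = exp (card W * (l\<^sup>2 / 4 - l / 2))"
    by (simp add: exp_of_nat_mult)
  finally have "card ?D \<le> 2 ^ 2 ^ n * exp (card W * (l\<^sup>2 / 4 - l / 2)) / exp (- l * (card W / 2 - \<epsilon> * 2 ^ n))"
    by (simp add: pos_le_divide_eq)
  also have "\<dots> = 2 ^ 2 ^ n * exp (card W * (l\<^sup>2 / 4) - l * \<epsilon> * 2 ^ n)"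
    unfolding times_divide_eq_right[symmetric] exp_diff[symmetric] by (simp add: algebra_simps)
  also have "\<dots> \<le> 2 ^ 2 ^ n * exp (- \<epsilon>\<^sup>2 * 2 ^ n)"
  proof -
    have "card W * \<epsilon>\<^sup>2 \<le> 2 ^ n * \<epsilon>\<^sup>2" using cW by (intro mult_right_mono) simp_all
    then show ?thesis by (simp add: l_def power2_eq_square algebra_simps)
  qed
  finally show ?thesis .
qed

lemma card_deviating_le:
  assumes "W \<subseteq> cube n" "0 \<le> \<epsilon>"
  shows "card (deviating n \<epsilon> W) \<le> 2 * 2 ^ 2 ^ n * exp (- \<epsilon>\<^sup>2 * 2 ^ n)"
proof -
  let ?D = "\<lambda>s. {g \<in> bool_funs n. real (card {x \<in> W. g x = s}) < card W / 2 - \<epsilon> * 2 ^ n}"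
  have "deviating n \<epsilon> W = ?D True \<union> ?D False"
    unfolding deviating_def by (auto simp: ex_bool_eq)
  then have "card (deviating n \<epsilon> W) \<le> card (?D True) + card (?D False)" by (simp add: card_Un_le)
  then have "real (card (deviating n \<epsilon> W)) \<le> real (card (?D True)) + real (card (?D False))" by linarith
  also have "\<dots> \<le> 2 ^ 2 ^ n * exp (- \<epsilon>\<^sup>2 * 2 ^ n) + 2 ^ 2 ^ n * exp (- \<epsilon>\<^sup>2 * 2 ^ n)"
    by (intro add_mono card_one_sided_deviation_le assms)
  finally show ?thesis by simp
qed

section \<open>Common paths and test sets\<close>

text \<open>The children of the node \<open>u\<close> in the tree behind \<open>thick\<close>;
  \<open>L\<close> is the mask of the coordinates after the child.\<close>

definition branches :: "real \<Rightarrow> bool list \<Rightarrow> 'a list \<Rightarrow> 'a list set \<Rightarrow> 'a set" where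
  "branches t L u X = {\<sigma>. thick t L {xs. u @ \<sigma> # xs \<in> X}}"

text \<open>Descend both trees at once. At marked coordinates where \<open>a\<close> and
  \<open>b\<close> differ, both nodes have more than \<open>t\<close> children and share one;
  elsewhere each path takes any child. The paths may thus diverge, so the prefixes \<open>u\<close>
  and \<open>v\<close> are independent.\<close>

lemma thick_common_path:
  assumes "thick t K X" "thick t K Y" "length a = length K" "length b = length K" "0 \<le> t"
    and "\<And>i u v. i < length K \<Longrightarrow> K ! i \<Longrightarrow> a ! i \<noteq> b ! i \<Longrightarrow> length u = i \<Longrightarrow> length v = i \<Longrightarrow>
           t < card (branches t (drop (Suc i) K) u X) \<Longrightarrow>
           t < card (branches t (drop (Suc i) K) v Y) \<Longrightarrow>
           branches t (drop (Suc i) K) u X \<inter> branches t (drop (Suc i) K) v Y \<noteq> {}"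
  shows "\<exists>x\<in>X. \<exists>y\<in>Y. \<forall>i<length K. K ! i \<and> a ! i \<noteq> b ! i \<longrightarrow> x ! i = y ! i"
  using assms
proof (induction K arbitrary: X Y a b)
  case (Cons k K)
  obtain a0 a' b0 b' where ab: "a = a0 # a'" "b = b0 # b'" "length a' = length K" "length b' = length K"
    using Cons.prems(3,4) by (metis length_Suc_conv)
  let ?NX = "branches t K [] X" and ?NY = "branches t K [] Y"
  have ne: "?NX \<noteq> {}" "?NY \<noteq> {}"
    using Cons.prems(1,2)[THEN thick_Cons_imp_ex, OF Cons.prems(5)] by (auto simp: branches_def)
  have "\<exists>\<sigma>\<in>?NX. \<exists>\<sigma>'\<in>?NY. k \<and> a0 \<noteq> b0 \<longrightarrow> \<sigma> = \<sigma>'"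
  proof (cases "k \<and> a0 \<noteq> b0")
    case True
    then have "?NX \<inter> ?NY \<noteq> {}"
      using Cons.prems(1,2) Cons.prems(6)[of 0 "[]" "[]"] by (auto simp: ab branches_def)
    then show ?thesis by blast
  qed (use ne in blast)
  then obtain \<sigma> \<sigma>' where \<sigma>: "\<sigma> \<in> ?NX" "\<sigma>' \<in> ?NY" "k \<and> a0 \<noteq> b0 \<longrightarrow> \<sigma> = \<sigma>'" by blast
  have "\<exists>x\<in>{xs. \<sigma> # xs \<in> X}. \<exists>y\<in>{xs. \<sigma>' # xs \<in> Y}. \<forall>i<length K. K ! i \<and> a' ! i \<noteq> b' ! i \<longrightarrow> x ! i = y ! i"
  proof (rule Cons.IH)
    fix i u v
    assume "i < length K" "K ! i" "a' ! i \<noteq> b' ! i" "length u = i" "length v = i"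
      "t < card (branches t (drop (Suc i) K) u {xs. \<sigma> # xs \<in> X})"
      "t < card (branches t (drop (Suc i) K) v {xs. \<sigma>' # xs \<in> Y})"
    then show "branches t (drop (Suc i) K) u {xs. \<sigma> # xs \<in> X} \<inter>
        branches t (drop (Suc i) K) v {xs. \<sigma>' # xs \<in> Y} \<noteq> {}"
      using Cons.prems(6)[of "Suc i" "\<sigma> # u" "\<sigma>' # v"] by (simp add: ab branches_def)
  qed (use \<sigma> ab Cons.prems(5) in \<open>auto simp: branches_def\<close>)
  then obtain x y where xy: "\<sigma> # x \<in> X" "\<sigma>' # y \<in> Y" "\<forall>i<length K. K ! i \<and> a' ! i \<noteq> b' ! i \<longrightarrow> x ! i = y ! i"
    by blast
  have "\<forall>i<length (k # K). (k # K) ! i \<and> a ! i \<noteq> b ! i \<longrightarrow> (\<sigma> # x) ! i = (\<sigma>' # y) ! i"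
    using \<sigma>(3) xy(3) by (auto simp: ab less_Suc_eq_0_disj)
  with xy show ?case by blast
qed auto

text \<open>All sets that the other function will have to split. They depend on \<open>g\<close> and
  its fibers only; \<open>L\<close> ranges over all short masks, so one family serves every mask
  \<open>K\<close>.\<close>

definition test_sets ::
  "nat \<Rightarrow> nat \<Rightarrow> real \<Rightarrow> (bool list \<Rightarrow> bool) \<Rightarrow> (bool list \<Rightarrow> bool list list set) \<Rightarrow> bool list set set" where
  "test_sets m n t g Z =
     range (\<lambda>s. {x \<in> cube n. g x = s}) \<union>
     (\<lambda>(a, u, L). branches t L u (Z a)) `
       (cube m \<times> {u. set u \<subseteq> cube n \<and> length u \<le> m} \<times> {L. length L \<le> m})"

lemma finite_bool_lists_le [simp]: "finite {L :: bool list. length L \<le> m}"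
  using finite_lists_length_le[of "UNIV :: bool set" m] by simp

lemma finite_test_sets [simp, intro]: "finite (test_sets m n t g Z)"
  unfolding test_sets_def
  by (intro finite_UnI finite_imageI finite_cartesian_product finite_lists_length_le finite_bool_lists_le
      finite_cube finite)

lemma sum_powers_le:
  assumes "2 \<le> (x :: nat)"
  shows "(\<Sum>i\<le>m. x ^ i) \<le> 2 * x ^ m"
proof (induction m)
  case (Suc m)
  then have "(\<Sum>i\<le>Suc m. x ^ i) \<le> 2 * x ^ m + x ^ Suc m" by simp
  also have "\<dots> \<le> 2 * x ^ Suc m" using assms by simp
  finally show ?case .
qed simp

text \<open>Two sides of \<open>g\<close>, and 2^m choices of \<open>a\<close>, at most 2 * 2^(mn)
  prefixes and 2 * 2^m masks. With 1 \<le> n the alphabet has two letters, so the last term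
  dominates the geometric sum of prefixes.\<close>

lemma card_test_sets_le:
  assumes "1 \<le> n"
  shows "card (test_sets m n t g Z) \<le> 2 ^ (m * n + 2 * m + 3)"
proof -
  have 2: "2 \<le> (2::nat) ^ n" using assms self_le_power[of 2 n] by simp
  let ?U = "{u. set u \<subseteq> cube n \<and> length u \<le> m}" and ?L = "{L :: bool list. length L \<le> m}"
  let ?P = "cube m \<times> ?U \<times> ?L"
  have "card ?U = (\<Sum>i\<le>m. (2 ^ n) ^ i)" by (simp add: card_lists_length_le card_cube)
  then have U: "card ?U \<le> 2 * (2 ^ n) ^ m" using sum_powers_le[OF 2, of m] by simp
  have "card ?L = (\<Sum>i\<le>m. 2 ^ i)" using card_lists_length_le[of "UNIV :: bool set" m] by simp
  then have L: "card ?L \<le> 2 * 2 ^ m" using sum_powers_le[of 2 m] by simp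
  have fin: "finite ?P" 
    by (intro finite_cartesian_product finite_lists_length_le finite_bool_lists_le finite_cube)
  have "card ?P \<le> 2 ^ m * ((2 * (2 ^ n) ^ m) * (2 * 2 ^ m))"
    unfolding card_cartesian_product card_cube by (intro mult_mono U L) auto
  also have "\<dots> = 4 * 2 ^ (m * n + 2 * m)"
  proof -
    have "(2::nat) ^ (2 * m) = 2 ^ m * 2 ^ m" by (simp add: mult_2 power_add)
    moreover have "((2::nat) ^ n) ^ m = 2 ^ (m * n)" by (metis mult.commute power_mult)
    ultimately show ?thesis by (simp only: power_add) simp
  qed
  finally have P: "card ?P \<le> 4 * 2 ^ (m * n + 2 * m)" .
  have "card (test_sets m n t g Z) \<le> card (range (\<lambda>s. {x \<in> cube n. g x = s})) +
      card ((\<lambda>(a, u, L). branches t L u (Z a)) ` ?P)"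
    unfolding test_sets_def by (rule card_Un_le)
  also have "\<dots> \<le> card (UNIV :: bool set) + card ?P"
    by (intro add_mono card_image_le fin finite)
  also have "\<dots> \<le> 2 + 4 * 2 ^ (m * n + 2 * m)" using P by simp
  also have "\<dots> \<le> 8 * 2 ^ (m * n + 2 * m)"
    using one_le_power[of "2::nat" "m * n + 2 * m"] by linarith
  also have "\<dots> = 2 ^ (m * n + 2 * m + 3)" by (simp add: power_add)
  finally show ?thesis .
qed


lemma finite_matrices: "finite (matrices m n)"
proof -
  have "matrices m n = {X. set X \<subseteq> cube n \<and> length X = m}" by (auto simp: matrices_def)
  then show ?thesis by (simp add: finite_lists_length_eq)
qed

lemma row_preimage_subset: "row_preimage m n g a \<subseteq> matrices m n"
  by (auto simp: row_preimage_def)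

lemma finite_row_preimage [simp, intro]: "finite (row_preimage m n g a)"
  by (rule finite_subset[OF row_preimage_subset finite_matrices])

lemma card_balanced_side:
  assumes "g \<in> balanced_funs n"
  shows "2 * card {x \<in> cube n. g x = s} = 2 ^ n"
proof -
  have "card (cube n) = card ({x \<in> cube n. g x} \<union> {x \<in> cube n. \<not> g x})" by (rule arg_cong[where f = card]) auto
  also have "\<dots> = card {x \<in> cube n. g x} + card {x \<in> cube n. \<not> g x}" by (rule card_Un_disjoint) auto
  finally show ?thesis using assms by (cases s) (auto simp: balanced_funs_def card_cube)
qed

text \<open>The threshold 29/100 of the cube is 58/100 of either side of a balanced
  function.\<close>

definition unbalancing ::
  "nat \<Rightarrow> nat \<Rightarrow> (bool list \<Rightarrow> bool) \<Rightarrow> (bool list \<Rightarrow> bool list list set) \<Rightarrow> (bool list \<Rightarrow> bool) set" where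
  "unbalancing m n g Z = (\<Union>W\<in>test_sets m n (29 / 100 * 2 ^ n) g Z. deviating n (1 / 100) W)"

lemma branches_subset:
  assumes "0 \<le> t" "\<And>\<sigma> xs. u @ \<sigma> # xs \<in> X \<Longrightarrow> \<sigma> \<in> S"
  shows "branches t L u X \<subseteq> S"
proof
  fix \<sigma> assume "\<sigma> \<in> branches t L u X"
  then have "{xs. u @ \<sigma> # xs \<in> X} \<noteq> {}"
    unfolding branches_def using thick_nonempty[OF _ assms(1)] by blast
  then show "\<sigma> \<in> S" using assms(2) by blast
qed

text \<open>A matrix in the fiber has \<open>g\<close>-value \<open>a ! i\<close> at row
  \<open>i\<close>, so branching stays on one side of \<open>g\<close>. As the branching set is
  nonempty, \<open>u\<close> extends to such a matrix.\<close>

lemma branches_row_preimage: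
  assumes "Z \<subseteq> row_preimage m n g a" "0 \<le> t" "t < card (branches t L u Z)" "length u = i" "i < m"
  shows "branches t L u Z \<subseteq> {x \<in> cube n. g x = a ! i}" "set u \<subseteq> cube n"
proof -
  have mem: "set (u @ \<sigma> # xs) \<subseteq> cube n \<and> a = map g u @ g \<sigma> # map g xs" if "u @ \<sigma> # xs \<in> Z" for \<sigma> xs
  proof -
    have "u @ \<sigma> # xs \<in> row_preimage m n g a" using that assms(1) by blast
    then show ?thesis by (auto simp: row_preimage_def matrices_def)
  qed
  show "branches t L u Z \<subseteq> {x \<in> cube n. g x = a ! i}"
  proof (rule branches_subset[OF assms(2)])
    fix \<sigma> xs assume "u @ \<sigma> # xs \<in> Z"
    from mem[OF this] assms(4) show "\<sigma> \<in> {x \<in> cube n. g x = a ! i}" by (auto simp: nth_append)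
  qed
  have "branches t L u Z \<noteq> {}" using assms(2,3) by auto
  then obtain \<sigma> where "thick t L {xs. u @ \<sigma> # xs \<in> Z}" unfolding branches_def by blast
  then obtain xs where "u @ \<sigma> # xs \<in> Z" using thick_nonempty[OF _ assms(2)] by blast
  from mem[OF this] show "set u \<subseteq> cube n" by simp
qed

lemma branches_in_test_sets:
  assumes "a \<in> cube m" "set u \<subseteq> cube n" "length u \<le> m" "length L \<le> m"
  shows "branches t L u (Z a) \<in> test_sets m n t g Z"
  unfolding test_sets_def using assms by (intro UnI2 image_eqI[of _ _ "(a, u, L)"]) auto

lemma not_deviating:
  assumes "g \<in> bool_funs n" "g \<notin> deviating n \<epsilon> W"
  shows "card W / 2 - \<epsilon> * 2 ^ n \<le> card {x \<in> W. g x = s}"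
  using assms unfolding deviating_def by (auto simp: not_less)

text \<open>The trees branch into \<open>?W\<close>, on the side \<open>gA\<close> = a_i, and
  \<open>?V\<close>, on the side \<open>gB\<close> = b_i. Each function splits the test sets of the
  other, so both sets have a large part in the quarter where both equations hold, and these parts
  meet.\<close>

lemma weak_intersection:
  assumes gA: "gA \<in> balanced_funs n" and gB: "gB \<in> balanced_funs n"
    and cube: "a \<in> cube m" "b \<in> cube m" "K \<in> cube m"
    and ZA: "ZA a \<subseteq> row_preimage m n gA a" and ZB: "ZB b \<subseteq> row_preimage m n gB b"
    and thick: "thick (29 / 100 * 2 ^ n) K (ZA a)" "thick (29 / 100 * 2 ^ n) K (ZB b)"
    and good: "gB \<notin> unbalancing m n gA ZA" "gA \<notin> unbalancing m n gB ZB"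
  shows "\<exists>X\<in>ZA a. \<exists>Y\<in>ZB b. \<forall>i<m. K ! i \<and> a ! i \<noteq> b ! i \<longrightarrow> X ! i = Y ! i"
proof -
  let ?t = "29 / 100 * 2 ^ n :: real" and ?N = "2 ^ n :: real"
  have t0: "0 \<le> ?t" by simp
  have bf: "gA \<in> bool_funs n" "gB \<in> bool_funs n" using gA gB by (auto simp: balanced_funs_def)
  have lK: "length K = m" using cube by (simp add: cube_def)
  have "\<exists>X\<in>ZA a. \<exists>Y\<in>ZB b. \<forall>i<length K. K ! i \<and> a ! i \<noteq> b ! i \<longrightarrow> X ! i = Y ! i"
  proof (rule thick_common_path[OF thick])
    fix i u v
    let ?L = "drop (Suc i) K"
    let ?W = "branches ?t ?L u (ZA a)" and ?V = "branches ?t ?L v (ZB b)"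
    assume i: "i < length K" "a ! i \<noteq> b ! i" "length u = i" "length v = i"
      and big: "?t < card ?W" "?t < card ?V"
    define S where "S = {x \<in> cube n. gA x = a ! i}"
    have fS: "finite S" by (simp add: S_def)
    note W = branches_row_preimage[OF ZA t0 big(1) i(3) i(1)[unfolded lK]]
    note V = branches_row_preimage[OF ZB t0 big(2) i(4) i(1)[unfolded lK]]
    have tests: "?W \<in> test_sets m n ?t gA ZA" "?V \<in> test_sets m n ?t gB ZB"
      using W(2) V(2) i cube lK by (auto intro!: branches_in_test_sets)
    have "S \<in> test_sets m n ?t gA ZA" unfolding S_def test_sets_def by blast
    then have nd: "gB \<notin> deviating n (1 / 100) ?W" "gB \<notin> deviating n (1 / 100) S" "gA \<notin> deviating n (1 / 100) ?V"
      using good tests unfolding unbalancing_def by blast+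
    let ?P = "{x \<in> ?W. gB x = b ! i}" and ?Q = "{x \<in> ?V. gA x = a ! i}"
    let ?D = "{x \<in> S. gB x = b ! i}" and ?D' = "{x \<in> S. gB x = (\<not> b ! i)}"
    \<comment> \<open>Half of 29/100, less the slack 1/100.\<close>
    have P: "card ?P > 27 / 200 * ?N"
      using not_deviating[OF bf(2) nd(1), of "b ! i"] big(1) by linarith
    have Q: "card ?Q > 27 / 200 * ?N"
      using not_deviating[OF bf(1) nd(3), of "a ! i"] big(2) by linarith
    have "2 * card S = 2 ^ n" unfolding S_def by (rule card_balanced_side[OF gA])
    then have "2 * real (card S) = 2 ^ n" by (metis of_nat_mult of_nat_numeral of_nat_power)
    moreover have "card S = card ?D + card ?D'"
    proof -
      have "S = ?D \<union> ?D'" by auto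
      then have "card S = card (?D \<union> ?D')" by simp
      also have "\<dots> = card ?D + card ?D'" using fS by (intro card_Un_disjoint) auto
      finally show ?thesis .
    qed
    \<comment> \<open>\<open>S\<close> is half the cube, and at least 1/4 - 1/100 of the cube lies
      in \<open>?D'\<close>. Two subsets larger than 27/200 cannot be disjoint within
      26/100.\<close>
    ultimately have D: "card ?D \<le> 26 / 100 * ?N"
      using not_deviating[OF bf(2) nd(2), of "\<not> b ! i"] by linarith
    have sub: "?P \<subseteq> ?D" "?Q \<subseteq> ?D" using W(1) V(1) unfolding S_def by auto
    have "?P \<inter> ?Q \<noteq> {}"
    proof
      assume "?P \<inter> ?Q = {}"
      then have "card ?P + card ?Q = card (?P \<union> ?Q)"
        using finite_subset[OF sub(1)] finite_subset[OF sub(2)] fS by (subst card_Un_disjoint) auto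
      also have "\<dots> \<le> card ?D" using sub fS by (intro card_mono) auto
      finally have "real (card ?P) + real (card ?Q) \<le> real (card ?D)" by linarith
      moreover have "0 < ?N" by simp
      ultimately show False using P Q D by linarith
    qed
    then show "?W \<inter> ?V \<noteq> {}" by blast
  qed (use cube in \<open>simp_all add: cube_def\<close>)
  then show ?thesis by (simp add: lK)
qed

lemma finite_deviating: "finite (deviating n \<epsilon> W)"
  unfolding deviating_def by simp

text \<open>Union bound over the test sets with \<epsilon> = 1/100; the factor 2 for the two values
  of a function raises 3 to 4 in the exponent.\<close>

lemma card_unbalancing_le:
  assumes "1 \<le> n" "\<And>a. Z a \<subseteq> row_preimage m n g a"
  shows "card (unbalancing m n g Z) \<le> 2 ^ (m * n + 2 * m + 4) * 2 ^ 2 ^ n * exp (- (2 ^ n / 10000))"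
proof -
  let ?t = "29 / 100 * 2 ^ n :: real"
  let ?E = "2 ^ 2 ^ n * exp (- (2 ^ n / 10000)) :: real"
  have sub: "W \<subseteq> cube n" if W: "W \<in> test_sets m n ?t g Z" for W
  proof -
    from W consider s where "W = {x \<in> cube n. g x = s}" | a u L where "W = branches ?t L u (Z a)"
      unfolding test_sets_def by auto
    then show ?thesis
    proof cases
      case 2
      have "branches ?t L u (Z a) \<subseteq> cube n"
        using assms(2)[of a] by (intro branches_subset) (auto simp: row_preimage_def matrices_def)
      with 2 show ?thesis by simp
    qed auto
  qed
  have "card (unbalancing m n g Z) \<le> (\<Sum>W\<in>test_sets m n ?t g Z. card (deviating n (1 / 100) W))"
    unfolding unbalancing_def by (rule card_UN_le) simp
  then have "real (card (unbalancing m n g Z)) \<le> (\<Sum>W\<in>test_sets m n ?t g Z. real (card (deviating n (1 / 100) W)))"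
    by (metis of_nat_le_iff of_nat_sum)
  also have "\<dots> \<le> (\<Sum>W\<in>test_sets m n ?t g Z. 2 * ?E)"
  proof (rule sum_mono)
    fix W assume "W \<in> test_sets m n ?t g Z"
    from card_deviating_le[OF sub[OF this], of "1 / 100"]
    show "real (card (deviating n (1 / 100) W)) \<le> 2 * ?E" by (simp add: power2_eq_square)
  qed
  also have "\<dots> = card (test_sets m n ?t g Z) * (2 * ?E)" by simp
  also have "\<dots> \<le> 2 ^ (m * n + 2 * m + 3) * (2 * ?E)"
    using of_nat_mono[OF card_test_sets_le[OF assms(1), of m ?t g Z], where 'a = real]
    by (intro mult_right_mono) simp_all
  finally show ?thesis by (simp add: power_add)
qed

section \<open>Runs of a partially half-duplex protocol\<close>

lemma well_labeled_child_subset: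
  assumes "well_labeled (Node S c)"
  shows "inputs (c e) \<subseteq> S"
proof -
  obtain b where "e = Rcv b \<or> e = Send b" by (metis edge.exhaust)
  with assms show ?thesis by (cases b) auto
qed

lemma vertex_at_inputs_subset:
  assumes "well_labeled t" "vertex_at t p = Some u"
  shows "inputs u \<subseteq> inputs t" "well_labeled u"
proof -
  have "inputs u \<subseteq> inputs t \<and> well_labeled u"
    using assms
  proof (induction p arbitrary: t)
    case (Cons e p)
    then obtain S c where t: "t = Node S c" "vertex_at (c e) p = Some u"
      by (cases t) auto
    with Cons.prems have "well_labeled (c e)" by simp
    from Cons.IH[OF this t(2)] well_labeled_child_subset[of S c e] Cons.prems(1) show ?case
      unfolding t(1) by (metis hd_tree.sel(2) subset_trans)
  qed auto
  then show "inputs u \<subseteq> inputs t" "well_labeled u" by auto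
qed

lemma vertex_at_snoc:
  assumes "vertex_at t p = Some (Node S c)"
  shows "vertex_at t (p @ [e]) = Some (c e)"
  using assms by (induction p arbitrary: t) (auto split: hd_tree.splits)

lemma UNIV_edge: "(UNIV :: edge set) = {Rcv True, Rcv False, Send True, Send False}"
proof -
  have "e \<in> {Rcv True, Rcv False, Send True, Send False}" for e by (cases e; cases "edge_bit e") auto
  then show ?thesis by blast
qed

lemma vertex_at_depth:
  assumes "vertex_at t p = Some u"
  shows "length p + tree_depth u \<le> tree_depth t"
  using assms
proof (induction p arbitrary: t)
  case (Cons e p)
  then obtain S c where t: "t = Node S c" "vertex_at (c e) p = Some u"
    by (cases t) auto
  have "tree_depth (c e) \<le> Max (range (\<lambda>e. tree_depth (c e)))"
    by (intro Max_ge finite_imageI rangeI) (simp add: UNIV_edge)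
  with Cons.IH[OF t(2)] show ?case by (simp add: t)
qed auto

section \<open>Executions along a common transcript\<close>

definition possible_round :: "edge \<Rightarrow> edge \<Rightarrow> bool" where
  "possible_round d e \<longleftrightarrow> classical_round d e \<or> wasted_round d e \<or> silent_round d e"

lemma possible_round_same_bit: "edge_bit d = edge_bit e \<Longrightarrow> possible_round d e"
  by (cases d; cases e) (auto simp: possible_round_def)

lemma possible_rounds_same_bits:
  assumes "map edge_bit p = map edge_bit p'"
  shows "list_all2 possible_round p p'"
proof (rule list_all2_all_nthI)
  show "length p = length p'" using assms by (rule map_eq_imp_length_eq)
  then show "possible_round (p ! i) (p' ! i)" if "i < length p" for i
    using that assms by (metis nth_map possible_round_same_bit)
qed

text \<open>
  Even for different functions, two inputs consistent with the same transcript can be driven along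
  it: where both players send, the two bits agree, and where both receive, the adversary delivers
  the transcript.
\<close>

lemma run_along_paths:
  assumes "well_labeled t" "well_labeled t'" "vertex_at t p = Some u" "vertex_at t' p' = Some v"
    "x \<in> inputs u" "y \<in> inputs v" "list_all2 possible_round p p'"
  shows "run x y t t' (zip p p') u v"
  using assms(7,1-6)
proof (induction p p' arbitrary: t t' rule: list_all2_induct)
  case Nil
  then show ?case by (auto intro: run_Nil)
next
  case (Cons d p e p')
  obtain S c where t: "t = Node S c" "vertex_at (c d) p = Some u" using Cons.prems by (cases t) auto
  obtain T c' where t': "t' = Node T c'" "vertex_at (c' e) p' = Some v" using Cons.prems by (cases t') auto
  have wl: "well_labeled (c d)" "well_labeled (c' e)" using Cons.prems t t' by auto
  have "x \<in> inputs (c d)" "y \<in> inputs (c' e)"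
    using vertex_at_inputs_subset(1)[OF wl(1) t(2)] vertex_at_inputs_subset(1)[OF wl(2) t'(2)] Cons.prems by auto
  then show ?case
    using Cons.IH[OF wl t(2) t'(2) Cons.prems(5,6)] Cons.hyps
    by (auto simp: t(1) t'(1) possible_round_def intro!: run_Cons)
qed

text \<open>A transcript records bits only, so whether each edge is a send or a receipt is left to
  the path; in a well labeled tree, disjointness of labels leaves a given input at most one
  path.\<close>

definition at_vertex :: "('i, 'o) hd_tree \<Rightarrow> 'i \<Rightarrow> bool list \<Rightarrow> ('i, 'o) hd_tree \<Rightarrow> bool" where
  "at_vertex t x \<pi> u \<longleftrightarrow> (\<exists>p. map edge_bit p = \<pi> \<and> vertex_at t p = Some u \<and> x \<in> inputs u)"

definition sends :: "('i, 'o) hd_tree \<Rightarrow> 'i \<Rightarrow> bool list \<Rightarrow> bool \<Rightarrow> bool" where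
  "sends t x \<pi> \<sigma> \<longleftrightarrow> (\<exists>S c. at_vertex t x \<pi> (Node S c) \<and> x \<in> inputs (c (Send \<sigma>)))"

definition receives :: "('i, 'o) hd_tree \<Rightarrow> 'i \<Rightarrow> bool list \<Rightarrow> bool" where
  "receives t x \<pi> \<longleftrightarrow> (\<exists>S c. at_vertex t x \<pi> (Node S c) \<and> (\<forall>\<sigma>. x \<in> inputs (c (Rcv \<sigma>))))"

lemma consistent_iff_at_vertex: "x \<in> consistent_inputs t \<pi> \<longleftrightarrow> (\<exists>u. at_vertex t x \<pi> u)"
  by (auto simp: consistent_inputs_def at_vertex_def)

lemma at_vertex_snoc:
  assumes "at_vertex t x \<pi> (Node S c)" "x \<in> inputs (c e)"
  shows "at_vertex t x (\<pi> @ [edge_bit e]) (c e)"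
  using assms vertex_at_snoc[of t _ S c e] unfolding at_vertex_def
  by (metis list.map(1) list.map(2) map_append)

lemma sends_consistent: "sends t x \<pi> \<sigma> \<Longrightarrow> x \<in> consistent_inputs t (\<pi> @ [\<sigma>])"
  unfolding sends_def consistent_iff_at_vertex using at_vertex_snoc by fastforce

lemma receives_consistent: "receives t x \<pi> \<Longrightarrow> x \<in> consistent_inputs t (\<pi> @ [\<sigma>])"
  unfolding receives_def consistent_iff_at_vertex using at_vertex_snoc[of t x \<pi> _ _ "Rcv \<sigma>"] by fastforce

lemma sends_or_receives:
  assumes "well_labeled t" "at_vertex t x \<pi> (Node S c)"
  shows "receives t x \<pi> \<or> (\<exists>\<sigma>. sends t x \<pi> \<sigma>)"
proof -
  have wl: "well_labeled (Node S c)" and "x \<in> S"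
    using assms vertex_at_inputs_subset(2) unfolding at_vertex_def by fastforce+
  then consider "x \<in> inputs (c (Rcv False))" "x \<in> inputs (c (Rcv True))" | \<sigma> where "x \<in> inputs (c (Send \<sigma>))"
    by auto
  then show ?thesis
  proof cases
    case 1
    then have "x \<in> inputs (c (Rcv \<sigma>))" for \<sigma> by (cases \<sigma>) auto
    with assms(2) show ?thesis unfolding receives_def by blast
  qed (use assms(2) in \<open>auto simp: sends_def\<close>)
qed

locale kwmux_protocol =
  fixes m n :: nat and f :: "bool list \<Rightarrow> bool" and prot :: kwmux_protocol
  assumes phd: "partially_half_duplex m n f prot" and solves: "kwmux_solves m n f prot"
begin

abbreviation "tA \<equiv> fst prot"
abbreviation "tB \<equiv> snd prot"

lemma protocol: "half_duplex_protocol (alice_inputs m n f) (bob_inputs m n f) prot"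
  using phd by (simp add: partially_half_duplex_def)

lemma wl: "well_labeled tA" "well_labeled tB"
  and root: "inputs tA = alice_inputs m n f" "inputs tB = bob_inputs m n f"
  using protocol by (auto simp: half_duplex_protocol_def)

lemma at_vertex_input:
  "at_vertex tA x \<pi> u \<Longrightarrow> x \<in> alice_inputs m n f" "at_vertex tB y \<pi> v \<Longrightarrow> y \<in> bob_inputs m n f"
  unfolding at_vertex_def root[symmetric]
  using vertex_at_inputs_subset(1)[OF wl(1)] vertex_at_inputs_subset(1)[OF wl(2)] by (meson subsetD)+

lemma ex_run:
  assumes "at_vertex tA x \<pi> u" "at_vertex tB y \<pi> v"
  shows "\<exists>rs. run x y tA tB rs u v"
proof -
  obtain p p' where p: "map edge_bit p = \<pi>" "vertex_at tA p = Some u" "x \<in> inputs u"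
    "map edge_bit p' = \<pi>" "vertex_at tB p' = Some v" "y \<in> inputs v"
    using assms unfolding at_vertex_def by blast
  have "list_all2 possible_round p p'" using p(1,4) by (intro possible_rounds_same_bits) simp
  from run_along_paths[OF wl p(2,5,3,6) this] show ?thesis ..
qed

text \<open>Inputs consistent with one transcript are joined by a run even if their functions
  differ, so the agreement demanded of runs holds for every such pair.\<close>

lemma same_leaf:
  assumes "at_vertex tA x \<pi> u" "at_vertex tB y \<pi> v"
  shows "is_Leaf u \<longleftrightarrow> is_Leaf v" "is_Leaf u \<Longrightarrow> leaf_output u = leaf_output v"
proof -
  obtain rs where "run x y tA tB rs u v" using ex_run[OF assms] ..
  with protocol at_vertex_input(1)[OF assms(1)] at_vertex_input(2)[OF assms(2)]
  have "(is_Leaf u \<longleftrightarrow> is_Leaf v) \<and> (is_Leaf u \<longrightarrow> leaf_output u = leaf_output v)"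
    unfolding half_duplex_protocol_def by simp
  then show "is_Leaf u \<longleftrightarrow> is_Leaf v" "is_Leaf u \<Longrightarrow> leaf_output u = leaf_output v" by simp_all
qed

lemma output_valid:
  assumes "at_vertex tA x \<pi> u" "at_vertex tB y \<pi> v" "is_Leaf u"
  shows "kwmux_valid m n x y (leaf_output u)"
proof -
  obtain rs where "run x y tA tB rs u v" using ex_run[OF assms(1,2)] ..
  moreover have "is_Leaf v" using same_leaf(1)[OF assms(1,2)] assms(3) by simp
  ultimately show ?thesis
    using solves at_vertex_input(1)[OF assms(1)] at_vertex_input(2)[OF assms(2)] assms(3)
    unfolding kwmux_solves_def hd_solves_def by meson
qed

text \<open>The run along the transcript, extended by the pair \<open>(d, e)\<close>, is a run on
  inputs with a common function, where every round is classical.\<close>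

lemma last_round_classical:
  assumes "at_vertex tA (g, X) \<pi> (Node S c)" "(g, X) \<in> inputs (c d)"
    "at_vertex tB (g, Y) \<pi> (Node T c')" "(g, Y) \<in> inputs (c' e)" "possible_round d e"
  shows "classical_round d e"
proof -
  obtain p p' where p: "map edge_bit p = \<pi>" "vertex_at tA p = Some (Node S c)"
    "map edge_bit p' = \<pi>" "vertex_at tB p' = Some (Node T c')"
    using assms unfolding at_vertex_def by blast
  have len: "length p = length p'" using p(1,3) by (metis length_map)
  have "list_all2 possible_round p p'"
    using p(1,3) by (intro possible_rounds_same_bits) simp
  then have "list_all2 possible_round (p @ [d]) (p' @ [e])"
    using assms(5) len by (simp add: list_all2_append)
  then have "run (g, X) (g, Y) tA tB (zip (p @ [d]) (p' @ [e])) (c d) (c' e)"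
    by (rule run_along_paths[OF wl vertex_at_snoc[OF p(2)] vertex_at_snoc[OF p(4)] assms(2) assms(4)])
  moreover have "(d, e) \<in> set (zip (p @ [d]) (p' @ [e]))" using len by simp
  moreover have "\<forall>rs u v. run (g, X) (g, Y) tA tB rs u v \<longrightarrow> (\<forall>(d, e)\<in>set rs. classical_round d e)"
    using phd at_vertex_input(1)[OF assms(1)] at_vertex_input(2)[OF assms(3)]
    unfolding partially_half_duplex_def by simp
  ultimately show ?thesis by blast
qed

lemma not_both_send:
  assumes "sends tA (g, X) \<pi> \<sigma>"
  shows "\<not> sends tB (g, Y) \<pi> \<tau>"
proof
  assume "sends tB (g, Y) \<pi> \<tau>"
  with assms obtain S c T c' where
    "at_vertex tA (g, X) \<pi> (Node S c)" "(g, X) \<in> inputs (c (Send \<sigma>))"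
    "at_vertex tB (g, Y) \<pi> (Node T c')" "(g, Y) \<in> inputs (c' (Send \<tau>))"
    unfolding sends_def by blast
  from last_round_classical[OF this] show False by (simp add: possible_round_def)
qed

lemma not_both_receive:
  assumes "receives tA (g, X) \<pi>"
  shows "\<not> receives tB (g, Y) \<pi>"
proof
  assume "receives tB (g, Y) \<pi>"
  with assms obtain S c T c' where
    "at_vertex tA (g, X) \<pi> (Node S c)" "(g, X) \<in> inputs (c (Rcv False))"
    "at_vertex tB (g, Y) \<pi> (Node T c')" "(g, Y) \<in> inputs (c' (Rcv False))"
    unfolding receives_def by blast
  from last_round_classical[OF this] show False by (simp add: possible_round_def)
qed

lemma alice_cases:
  assumes "at_vertex tA x \<pi> u" "\<not> is_Leaf u"
  shows "receives tA x \<pi> \<or> (\<exists>\<sigma>. sends tA x \<pi> \<sigma>)"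
proof (cases u)
  case (Node S c)
  with assms show ?thesis using sends_or_receives[OF wl(1)] by simp
qed (use assms in simp)

lemma bob_cases:
  assumes "at_vertex tB y \<pi> v" "\<not> is_Leaf v"
  shows "receives tB y \<pi> \<or> (\<exists>\<sigma>. sends tB y \<pi> \<sigma>)"
proof (cases v)
  case (Node S c)
  with assms show ?thesis using sends_or_receives[OF wl(2)] by simp
qed (use assms in simp)

section \<open>Live transcripts and the speaking player\<close>

definition live :: "bool list \<Rightarrow> (bool list \<Rightarrow> bool) \<Rightarrow> bool" where
  "live \<pi> g \<longleftrightarrow> X_of prot \<pi> g \<noteq> {} \<and> Y_of prot \<pi> g \<noteq> {}"

text \<open>On a live transcript one sending input decides for all: Bob's inputs with
  \<open>g\<close> cannot send then, hence receive, so that no input of Alice with \<open>g\<close>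
  can receive.\<close>

definition alice_speaks :: "bool list \<Rightarrow> (bool list \<Rightarrow> bool) \<Rightarrow> bool" where
  "alice_speaks \<pi> g \<longleftrightarrow> (\<exists>X \<sigma>. sends tA (g, X) \<pi> \<sigma>)"

lemma liveE:
  assumes "live \<pi> g"
  obtains X Y u v where "at_vertex tA (g, X) \<pi> u" "at_vertex tB (g, Y) \<pi> v"
proof -
  obtain X Y where "(g, X) \<in> consistent_inputs tA \<pi>" "(g, Y) \<in> consistent_inputs tB \<pi>"
    using assms unfolding live_def X_of_def Y_of_def by auto
  then show thesis unfolding consistent_iff_at_vertex using that by (elim exE) 
qed

lemma liveI:
  assumes "(g, X) \<in> consistent_inputs tA \<pi>" "(g, Y) \<in> consistent_inputs tB \<pi>"
  shows "live \<pi> g"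
  using assms unfolding live_def X_of_def Y_of_def by auto

text \<open>By liveness the leaf is also an end for a Bob input with the function \<open>g\<close>,
  for which the rejecting output is invalid. The output is thus a pair, and it must be valid for
  \<open>(h, Y)\<close> too.\<close>

lemma leaf_case:
  assumes u: "at_vertex tA (g, X) \<pi> u" and v: "at_vertex tB (h, Y) \<pi> v"
    and "is_Leaf u" "live \<pi> g"
  shows "\<exists>i j. kwmux_valid m n (g, X) (h, Y) (Some (i, j))"
proof -
  obtain Y' v' where v': "at_vertex tB (g, Y') \<pi> v'" using \<open>live \<pi> g\<close> by (rule liveE)
  have "leaf_output u \<noteq> None"
  proof
    assume "leaf_output u = None"
    with output_valid[OF u v' \<open>is_Leaf u\<close>] show False by (simp add: kwmux_valid_def)
  qed
  then obtain i j where "leaf_output u = Some (i, j)" by auto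
  with output_valid[OF u v \<open>is_Leaf u\<close>] show ?thesis by metis
qed

text \<open>
  If \<open>g\<close> and \<open>h\<close> agree on which continuations are live and on who speaks, then every round of the
  execution on \<open>((g, X), (h, Y))\<close> is classical and stays live for both, so that it ends in a leaf
  that is also reached by inputs sharing the function \<open>g\<close>.
\<close>

lemma same_colour_output:
  assumes live: "\<And>\<rho>. length \<rho> \<le> c \<Longrightarrow> live (\<pi>\<^sub>1 @ \<rho>) g = live (\<pi>\<^sub>1 @ \<rho>) h"
    and speaks: "\<And>\<rho>. length \<rho> \<le> c \<Longrightarrow> alice_speaks (\<pi>\<^sub>1 @ \<rho>) g = alice_speaks (\<pi>\<^sub>1 @ \<rho>) h"
    and depth: "tree_depth tA \<le> length \<pi>\<^sub>1 + c"
    and "length \<rho> + k = c" "live (\<pi>\<^sub>1 @ \<rho>) g"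
    and "(g, X) \<in> consistent_inputs tA (\<pi>\<^sub>1 @ \<rho>)" "(h, Y) \<in> consistent_inputs tB (\<pi>\<^sub>1 @ \<rho>)"
  shows "\<exists>i j. kwmux_valid m n (g, X) (h, Y) (Some (i, j))"
  using assms(4-7)
proof (induction k arbitrary: \<rho>)
  case (0 \<rho>)
  then obtain u v where u: "at_vertex tA (g, X) (\<pi>\<^sub>1 @ \<rho>) u" and v: "at_vertex tB (h, Y) (\<pi>\<^sub>1 @ \<rho>) v"
    by (auto simp: consistent_iff_at_vertex)
  obtain p where "map edge_bit p = \<pi>\<^sub>1 @ \<rho>" "vertex_at tA p = Some u"
    using u unfolding at_vertex_def by blast
  moreover from this have "length p = length \<pi>\<^sub>1 + length \<rho>" by (metis length_append length_map)
  ultimately have "tree_depth u = 0" using vertex_at_depth[of tA p u] depth 0(1) by simp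
  then have "is_Leaf u" by (cases u) auto
  then show ?case using leaf_case[OF u v] 0(2) by blast
next
  case (Suc k \<rho>)
  let ?\<pi> = "\<pi>\<^sub>1 @ \<rho>"
  have len: "length \<rho> \<le> c" "length (\<rho> @ [\<sigma>]) \<le> c" for \<sigma> using Suc.prems(1) by auto
  obtain u v where u: "at_vertex tA (g, X) ?\<pi> u" and v: "at_vertex tB (h, Y) ?\<pi> v"
    using Suc.prems(3,4) by (auto simp: consistent_iff_at_vertex)
  obtain Y' v' where v': "at_vertex tB (g, Y') ?\<pi> v'" using Suc.prems(2) by (rule liveE)
  obtain X' u' where u': "at_vertex tA (h, X') ?\<pi> u'"
    using Suc.prems(2) unfolding live[OF len(1)] by (rule liveE)
  have next_round: ?case
    if "(g, X) \<in> consistent_inputs tA (?\<pi> @ [\<sigma>])" "(h, Y) \<in> consistent_inputs tB (?\<pi> @ [\<sigma>])"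
      and "live (?\<pi> @ [\<sigma>]) g" for \<sigma>
    using Suc.IH[of "\<rho> @ [\<sigma>]"] that Suc.prems(1) by simp
  show ?case
  proof (cases "is_Leaf u")
    case True
    with leaf_case[OF u v] Suc.prems(2) show ?thesis by blast
  next
    case False
    then have nl: "\<not> is_Leaf v" "\<not> is_Leaf v'" "\<not> is_Leaf u'"
      using same_leaf(1)[OF u v] same_leaf(1)[OF u v'] same_leaf(1)[OF u' v] by auto
    show ?thesis
    proof (cases "\<exists>\<sigma>. sends tA (g, X) ?\<pi> \<sigma>")
      case True
      then obtain \<sigma> where \<sigma>: "sends tA (g, X) ?\<pi> \<sigma>" by blast
      \<comment> \<open>By the colour, Alice also sends for some input with \<open>h\<close>, so
        Bob's inputs with \<open>h\<close> must receive and the round is classical.\<close>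
      then have "alice_speaks ?\<pi> h" using speaks[OF len(1)] unfolding alice_speaks_def by blast
      then obtain X'' \<tau> where "sends tA (h, X'') ?\<pi> \<tau>" unfolding alice_speaks_def by blast
      then have Y: "receives tB (h, Y) ?\<pi>"
        using bob_cases[OF v nl(1)] not_both_send by blast
      have Y': "receives tB (g, Y') ?\<pi>"
        using bob_cases[OF v' nl(2)] not_both_send[OF \<sigma>] by blast
      show ?thesis
        by (rule next_round[OF sends_consistent[OF \<sigma>] receives_consistent[OF Y]])
          (rule liveI[OF sends_consistent[OF \<sigma>] receives_consistent[OF Y']])
    next
      case False
      then have X: "receives tA (g, X) ?\<pi>" using alice_cases[OF u \<open>\<not> is_Leaf u\<close>] by blast
      then obtain \<tau> where "sends tB (g, Y') ?\<pi> \<tau>" 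
        using bob_cases[OF v' nl(2)] not_both_receive[OF X] by blast
      then have "\<not> alice_speaks ?\<pi> g" unfolding alice_speaks_def by (meson not_both_send)
      then have X': "receives tA (h, X') ?\<pi>"
        using speaks[OF len(1)] alice_cases[OF u' nl(3)] unfolding alice_speaks_def by blast
      then obtain \<sigma> where \<sigma>: "sends tB (h, Y) ?\<pi> \<sigma>"
        using bob_cases[OF v nl(1)] not_both_receive[OF X'] by blast
      \<comment> \<open>When Bob speaks, the next transcript is visibly live for \<open>h\<close>;
        the colour transfers this to \<open>g\<close>.\<close>
      have "live (?\<pi> @ [\<sigma>]) h"
        using receives_consistent[OF X'] sends_consistent[OF \<sigma>] by (rule liveI)
      then have "live (?\<pi> @ [\<sigma>]) g" using live[OF len(2)] by simp
      then show ?thesis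
        by (rule next_round[OF receives_consistent[OF X] sends_consistent[OF \<sigma>]])
    qed
  qed
qed

end

section \<open>Thick fibers\<close>

lemma row_preimage_eq_listset:
  assumes "length a = m"
  shows "row_preimage m n g a = listset (map (\<lambda>b. {x \<in> cube n. g x = b}) a)"
  using assms
proof (induction a arbitrary: m)
  case Nil
  have "row_preimage 0 n g [] = {[]}" by (auto simp: row_preimage_def matrices_def)
  with Nil show ?case by simp
next
  case (Cons b a)
  have "row_preimage (Suc (length a)) n g (b # a) =
      set_Cons {x \<in> cube n. g x = b} (row_preimage (length a) n g a)"
    unfolding row_preimage_def matrices_def set_Cons_def
    by (intro set_eqI iffI; clarsimp simp: map_eq_Cons_conv length_Suc_conv)
  also have "\<dots> = listset (map (\<lambda>b. {x \<in> cube n. g x = b}) (b # a))"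
    unfolding Cons.IH[OF refl] by simp
  finally show ?case using Cons.prems by simp
qed

lemma card_set_Cons: "card (set_Cons S T) = card S * card T"
proof -
  have "set_Cons S T = (\<lambda>(x, xs). x # xs) ` (S \<times> T)"
    by (auto simp: set_Cons_def)
  moreover have "inj_on (\<lambda>(x, xs). x # xs) (S \<times> T)"
    by (auto simp: inj_on_def)
  ultimately show ?thesis by (simp add: card_image card_cartesian_product)
qed

lemma card_row_preimage:
  assumes "g \<in> balanced_funs n" "a \<in> cube m" "2 * q = 2 ^ n"
  shows "card (row_preimage m n g a) = q ^ m"
proof -
  have side: "card {x \<in> cube n. g x = b} = q" for b
    using card_balanced_side[OF assms(1), of b] assms(3) by linarith
  have "card (listset (map (\<lambda>b. {x \<in> cube n. g x = b}) a)) = q ^ length a" for a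
    by (induction a) (simp_all add: card_set_Cons side)
  moreover have "length a = m" using assms(2) by (simp add: cube_def)
  ultimately show ?thesis by (simp only: row_preimage_eq_listset)
qed

text \<open>The fiber lies in a product of sides of \<open>g\<close>, each of size q = 2^(n-1). With
  \<tau> = 58/100 the threshold \<tau> q is 29/100 of the cube and the marking probability is
  42/100.\<close>

lemma density_le_fiber_thick_weight:
  fixes \<delta> :: real
  assumes g: "g \<in> balanced_funs n" and a: "a \<in> cube m" and Z: "Z \<subseteq> row_preimage m n g a"
    and dense: "\<delta> * card (row_preimage m n g a) \<le> card Z" and "1 \<le> n"
  shows "\<delta> \<le> (\<Sum>K | K \<in> cube m \<and> thick (29 / 100 * 2 ^ n) K Z. weight (42 / 100) K)"
proof -
  define q where "q = (2::nat) ^ (n - 1)"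
  have q: "2 * q = 2 ^ n" using \<open>1 \<le> n\<close> by (simp add: q_def flip: power_Suc)
  then have "2 * real q = 2 ^ n" by (metis of_nat_mult of_nat_numeral of_nat_power)
  then have t: "58 / 100 * real q = 29 / 100 * 2 ^ n" by linarith
  let ?Ss = "map (\<lambda>b. {x \<in> cube n. g x = b}) a"
  have len: "length a = m" using a by (simp add: cube_def)
  have side: "card {x \<in> cube n. g x = b} = q" for b
    using card_balanced_side[OF g, of b] q by linarith
  have "real (card Z) \<le> real q ^ length ?Ss *
      (\<Sum>K | K \<in> cube (length ?Ss) \<and> thick (58 / 100 * q) K Z. weight (1 - 58 / 100) K)"
  proof (rule density_le_thick_weight)
    show "Z \<subseteq> listset ?Ss" using Z row_preimage_eq_listset[OF len] by simp
    show "finite S \<and> card S = q" if "S \<in> set ?Ss" for S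
      using that side by auto
  qed simp_all
  also have "length ?Ss = m" using len by simp
  also have "1 - 58 / 100 = (42 / 100 :: real)" by simp
  also note t
  finally have "real q ^ m * \<delta> \<le>
      real q ^ m * (\<Sum>K | K \<in> cube m \<and> thick (29 / 100 * 2 ^ n) K Z. weight (42 / 100) K)"
    using dense unfolding card_row_preimage[OF g a q] by (simp only: of_nat_power mult.commute)
  then show ?thesis by (rule mult_left_le_imp_le) (simp add: q_def)
qed

text \<open>Compare eighth powers of the bases: (2 - 0.42^2)^8 is about 122, below 2^7.\<close>

lemma random_mask_cost_le:
  "(2 - (42 / 100)\<^sup>2) ^ m \<le> 2 powr (7 / 8 * real m)"
proof -
  have "(2 - (42 / 100)\<^sup>2) ^ 8 \<le> (2 powr (7 / 8) :: real) ^ 8"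
    by (simp add: powr_power power2_eq_square power_divide divide_le_eq)
  then have "2 - (42 / 100)\<^sup>2 \<le> (2 powr (7 / 8) :: real)" by (rule power_le_imp_le_base[where n = 7, simplified]) simp
  then have "(2 - (42 / 100)\<^sup>2) ^ m \<le> (2 powr (7 / 8) :: real) ^ m"
    by (rule power_mono) (simp add: power2_eq_square)
  then show ?thesis by (simp add: powr_power mult.commute)
qed

text \<open>Otherwise any \<open>a\<close> and \<open>b\<close> with fibers thick for
  \<open>I\<close> and \<open>J\<close> differ outside \<open>meet I J\<close>, and the random masks
  separate the rectangle too cheaply.\<close>

lemma common_mask:
  assumes g: "g \<in> balanced_funs n" and "1 \<le> n" "1 \<le> m"
    and AB: "A \<subseteq> cube m" "B \<subseteq> cube m"
    and ZA: "\<And>a. a \<in> A \<Longrightarrow> ZA a \<subseteq> row_preimage m n g a"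
    and ZB: "\<And>b. b \<in> B \<Longrightarrow> ZB b \<subseteq> row_preimage m n g b"
    and denseA: "\<And>a. a \<in> A \<Longrightarrow> 2 powr (- real m / 24) * card (row_preimage m n g a) \<le> card (ZA a)"
    and denseB: "\<And>b. b \<in> B \<Longrightarrow> 2 powr (- real m / 24) * card (row_preimage m n g b) \<le> card (ZB b)"
    and L: "log 2 (rect_formula_complexity m A B) \<ge> 23 / 24 * m + 8 * log 2 m + 8"
  shows "\<exists>K\<in>cube m. \<exists>a\<in>A. \<exists>b\<in>B. thick (29 / 100 * 2 ^ n) K (ZA a) \<and> thick (29 / 100 * 2 ^ n) K (ZB b) \<and>
           (\<forall>i<m. \<not> K ! i \<longrightarrow> a ! i = b ! i)"
proof (rule ccontr)
  assume neg: "\<not> ?thesis"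
  let ?t = "29 / 100 * 2 ^ n :: real"
  define \<delta> where "\<delta> = 2 powr (- real m / 24)"
  have "separable m (2 * ((1 + real m) / \<delta>)\<^sup>2 * (2 - (42 / 100)\<^sup>2) ^ m) A B"
  proof (rule separable_by_random_masks[where F = "\<lambda>a K. thick ?t K (ZA a)" and G = "\<lambda>b K. thick ?t K (ZB b)"])
    show "\<delta> \<le> (\<Sum>K | K \<in> cube m \<and> thick ?t K (ZA a). weight (42 / 100) K)" if "a \<in> A" for a
      using density_le_fiber_thick_weight[OF g _ ZA[OF that] denseA[OF that] \<open>1 \<le> n\<close>] AB that
      by (auto simp: \<delta>_def)
    show "\<delta> \<le> (\<Sum>K | K \<in> cube m \<and> thick ?t K (ZB b). weight (42 / 100) K)" if "b \<in> B" for b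
      using density_le_fiber_thick_weight[OF g _ ZB[OF that] denseB[OF that] \<open>1 \<le> n\<close>] AB that
      by (auto simp: \<delta>_def)
    fix a b I J
    assume ab: "a \<in> A" "b \<in> B" and IJ: "I \<in> cube m" "J \<in> cube m"
      and th: "thick ?t I (ZA a)" "thick ?t J (ZB b)"
    have len: "length I = m" "length J = m" using IJ by (simp_all add: cube_def)
    have "thick ?t (meet I J) (ZA a)"
      using th(1) len finite_subset[OF ZA[OF ab(1)]] by (intro thick_meet) auto
    moreover have "thick ?t (meet J I) (ZB b)"
      using th(2) len finite_subset[OF ZB[OF ab(2)]] by (intro thick_meet) auto
    moreover have "meet I J \<in> cube m" using len by (simp add: cube_def)
    ultimately show "\<exists>i<m. \<not> meet I J ! i \<and> a ! i \<noteq> b ! i"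
      using neg ab by (metis meet_commute)
  qed (use AB in \<open>simp_all add: \<delta>_def\<close>)
  from rect_formula_complexity_le[OF this]
  have "real (rect_formula_complexity m A B) \<le> 2 * ((1 + real m) / \<delta>)\<^sup>2 * (2 - (42 / 100)\<^sup>2) ^ m" .
  also have "\<dots> \<le> 2 * ((1 + real m) / \<delta>)\<^sup>2 * 2 powr (7 / 8 * real m)"
    by (intro mult_left_mono random_mask_cost_le) simp
  also have "\<dots> = 2 * (1 + real m)\<^sup>2 * (2 powr (real m / 12) * 2 powr (7 / 8 * real m))"
  proof -
    have "1 / \<delta> = 2 powr (real m / 24)"
      unfolding \<delta>_def minus_divide_left[symmetric] powr_minus_divide by simp
    then have "(1 / \<delta>)\<^sup>2 = 2 powr (real m / 24) * 2 powr (real m / 24)"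
      by (simp only: power2_eq_square)
    also have "\<dots> = 2 powr (real m / 12)"
      by (subst powr_add[symmetric]) (rule arg_cong[where f = "(powr) 2"], simp)
    finally have d: "(1 / \<delta>)\<^sup>2 = 2 powr (real m / 12)" .
    have "((1 + real m) / \<delta>)\<^sup>2 = (1 + real m)\<^sup>2 * (1 / \<delta>)\<^sup>2"
      by (simp add: power_divide)
    then show ?thesis unfolding d by simp
  qed
  \<comment> \<open>This fixes \<gamma> = 1/24: the two densities cost 2 \<gamma>, the masks 7/8,
    and 2 \<gamma> + 7/8 = 1 - \<gamma>.\<close>
  also have "2 powr (real m / 12) * 2 powr (7 / 8 * real m) = 2 powr (23 / 24 * real m)"
    by (subst powr_add[symmetric]) (rule arg_cong[where f = "(powr) 2"], simp)
  finally have up: "real (rect_formula_complexity m A B) \<le> 2 * (1 + real m)\<^sup>2 * 2 powr (23 / 24 * real m)" .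
  have "0 \<le> log 2 (real m)" using \<open>1 \<le> m\<close> by simp
  then have "0 < log 2 (rect_formula_complexity m A B)" using L by linarith
  \<comment> \<open>The default value \<open>log 2 0 = 0\<close> is excluded by positivity.\<close>
  then have "rect_formula_complexity m A B \<noteq> 0" by (intro notI) (simp add: log_def)
  then have "2 powr (23 / 24 * m + 8 * log 2 m + 8) \<le> rect_formula_complexity m A B"
    using L by (intro le_log_iff[THEN iffD1]) simp_all
  also have "2 powr (23 / 24 * m + 8 * log 2 m + 8) = 2 powr (23 / 24 * m) * real m ^ 8 * 256"
  proof -
    have "2 powr (8 * log 2 (real m)) = real m ^ 8"
    proof -
      have "2 powr (8 * log 2 (real m)) = (2 powr log 2 (real m)) powr 8"
        by (simp only: powr_powr mult.commute)
      also have "\<dots> = real m powr 8" using \<open>1 \<le> m\<close> by simp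
      also have "\<dots> = real m ^ 8" by (rule powr_numeral) simp
      finally show ?thesis .
    qed
    then show ?thesis by (simp only: powr_add) simp
  qed
  finally have low: "2 powr (23 / 24 * m) * real m ^ 8 * 256 \<le> rect_formula_complexity m A B" .
  have "2 powr (23 / 24 * m) * (real m ^ 8 * 256) \<le> 2 powr (23 / 24 * real m) * (2 * (1 + real m)\<^sup>2)"
    using order_trans[OF low up] by (simp only: mult_ac)
  \<comment> \<open>The exponential factors cancel, and the polynomial slack of liveness exceeds the
    loss of the covers.\<close>
  then have "real m ^ 8 * 256 \<le> 2 * (1 + real m)\<^sup>2" by (rule mult_left_le_imp_le) simp
  also have "\<dots> \<le> 2 * (2 * real m)\<^sup>2"
    using \<open>1 \<le> m\<close> by (intro mult_left_mono power_mono) auto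
  also have "\<dots> = 8 * real m ^ 2" by (simp add: power_mult_distrib)
  also have "\<dots> \<le> 8 * real m ^ 8" using \<open>1 \<le> m\<close> by (intro mult_left_mono power_increasing) auto
  finally have "real m ^ 8 * 256 \<le> 8 * real m ^ 8" .
  moreover have "0 < real m ^ 8" using \<open>1 \<le> m\<close> by simp
  ultimately show False by linarith
qed

section \<open>Counting pairs and balanced functions\<close>

text \<open>Each of the two conditions excludes at most |S| \<beta> ordered pairs, together fewer
  than |S|^2.\<close>

lemma exists_good_pair:
  assumes "finite S" "0 \<le> \<beta>" and U: "\<And>g. g \<in> S \<Longrightarrow> finite (U g) \<and> real (card (U g)) \<le> \<beta>"
    and W: "\<And>g. g \<in> S \<Longrightarrow> finite (W g) \<and> real (card (W g)) \<le> \<beta>"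
    and "2 * \<beta> < card S"
  shows "\<exists>g\<in>S. \<exists>h\<in>S. h \<notin> U g \<and> g \<notin> W h"
proof (rule ccontr)
  assume neg: "\<not> ?thesis"
  have fin: "finite (SIGMA g:S. U g)" "finite (SIGMA g:S. W g)" using assms by auto
  have sig: "real (card (SIGMA g:S. V g)) \<le> card S * \<beta>"
    if "\<And>g. g \<in> S \<Longrightarrow> finite (V g) \<and> real (card (V g)) \<le> \<beta>" for V
  proof -
    have "real (card (SIGMA g:S. V g)) = (\<Sum>g\<in>S. real (card (V g)))"
      using that \<open>finite S\<close> by (subst card_SigmaI) auto
    also have "\<dots> \<le> (\<Sum>g\<in>S. \<beta>)" using that by (intro sum_mono) auto
    finally show ?thesis by simp
  qed
  have "S \<times> S \<subseteq> (SIGMA g:S. U g) \<union> prod.swap ` (SIGMA g:S. W g)"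
    using neg by (force simp: image_iff)
  then have "card (S \<times> S) \<le> card ((SIGMA g:S. U g) \<union> prod.swap ` (SIGMA g:S. W g))"
    using fin by (intro card_mono) auto
  also have "\<dots> \<le> card (SIGMA g:S. U g) + card (prod.swap ` (SIGMA g:S. W g))" by (rule card_Un_le)
  also have "\<dots> \<le> card (SIGMA g:S. U g) + card (SIGMA g:S. W g)" using card_image_le[OF fin(2)] by simp
  finally have "card S * card S \<le> card (SIGMA g:S. U g) + card (SIGMA g:S. W g)"
    by (simp only: card_cartesian_product)
  then have "real (card S) * real (card S) \<le> real (card (SIGMA g:S. U g)) + real (card (SIGMA g:S. W g))"
    by (metis of_nat_add of_nat_le_iff of_nat_mult)
  also have "\<dots> \<le> card S * \<beta> + card S * \<beta>" 
    using sig[of U, OF U] sig[of W, OF W] by linarith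
  finally have "real (card S) * real (card S) \<le> real (card S) * (2 * \<beta>)" by (simp add: algebra_simps)
  moreover have "0 < real (card S)" using \<open>0 \<le> \<beta>\<close> \<open>2 * \<beta> < card S\<close> by linarith
  ultimately have "real (card S) \<le> 2 * \<beta>" by (rule mult_left_le_imp_le)
  with \<open>2 * \<beta> < card S\<close> show False by linarith
qed

text \<open>Indicators of sets of q = 2^(n-1) points are balanced, and the central binomial
  coefficient is at least 4^q / (2 q).\<close>

lemma card_balanced_funs_ge:
  assumes "1 \<le> n"
  shows "2 ^ 2 ^ n / 2 ^ n \<le> real (card (balanced_funs n))"
proof -
  define q where "q = (2::nat) ^ (n - 1)"
  have q: "2 * q = 2 ^ n" using assms by (simp add: q_def flip: power_Suc)
  have "0 < q" by (simp add: q_def)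
  let ?T = "{T. T \<subseteq> cube n \<and> card T = q}" and ?h = "\<lambda>T. \<lambda>x\<in>cube n. x \<in> T"
  have sets: "{x \<in> cube n. ?h T x} = T" "{x \<in> cube n. \<not> ?h T x} = cube n - T" if "T \<subseteq> cube n" for T
    using that by auto
  have "inj_on ?h ?T"
  proof (rule inj_onI)
    fix T T' assume "T \<in> ?T" "T' \<in> ?T" and eq: "?h T = ?h T'"
    then have "T \<subseteq> cube n" "T' \<subseteq> cube n" by auto
    have "T = {x \<in> cube n. ?h T x}" by (rule sets(1)[symmetric]) fact
    also have "\<dots> = {x \<in> cube n. ?h T' x}" unfolding eq ..
    also have "\<dots> = T'" by (rule sets(1)) fact
    finally show "T = T'" .
  qed
  moreover have "?h ` ?T \<subseteq> balanced_funs n"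
  proof (intro subsetI, elim imageE CollectE conjE)
    fix g T assume T: "T \<subseteq> cube n" "card T = q" and g: "g = ?h T"
    have "card (cube n - T) = q"
      using T q finite_subset[OF T(1)] by (subst card_Diff_subset) (auto simp: card_cube)
    moreover have "{x \<in> cube n. g x} = T" unfolding g using T(1) by (rule sets(1))
    moreover have "{x \<in> cube n. \<not> g x} = cube n - T" unfolding g using T(1) by (rule sets(2))
    moreover have "g \<in> bool_funs n" unfolding g bool_funs_def by simp
    ultimately show "g \<in> balanced_funs n" using T(2) unfolding balanced_funs_def by simp
  qed
  moreover have "finite (balanced_funs n)" by (simp add: balanced_funs_def)
  ultimately have "card ?T \<le> card (balanced_funs n)" by (rule card_inj_on_le)
  moreover have "card ?T = (2 * q) choose q" using n_subsets[of "cube n" q] by (simp add: card_cube q)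
  ultimately have "real ((2 * q) choose q) \<le> real (card (balanced_funs n))" by simp
  moreover have "(4::real) ^ q / (2 * real q) = 2 ^ 2 ^ n / 2 ^ n"
  proof -
    have "(4::real) ^ q = 2 ^ (2 * q)" by (simp add: power_mult)
    moreover have "2 * real q = 2 ^ n" using q by (metis of_nat_mult of_nat_numeral of_nat_power)
    ultimately show ?thesis by (simp only: q)
  qed
  ultimately show ?thesis using central_binomial_lower_bound[OF \<open>0 < q\<close>] by simp
qed

section \<open>Counting colour classes\<close>

context kwmux_protocol
begin

definition colour :: "bool list \<Rightarrow> nat \<Rightarrow> (bool list \<Rightarrow> bool) \<Rightarrow> bool list set \<times> bool list set" where
  "colour \<pi> c g = ({\<rho>. length \<rho> \<le> c \<and> live (\<pi> @ \<rho>) g}, {\<rho>. length \<rho> \<le> c \<and> alice_speaks (\<pi> @ \<rho>) g})"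

text \<open>Equal colours force an output \<open>(i, j)\<close> with a_i \<noteq> b_i that separates
  row \<open>i\<close> of \<open>X\<close> from row \<open>i\<close> of \<open>Y\<close>, although
  these rows coincide.\<close>

lemma not_weakly_intersecting:
  assumes colour: "colour \<pi> c g = colour \<pi> c h" and depth: "tree_depth tA \<le> length \<pi> + c"
    and "live \<pi> g" and X: "X \<in> X_fiber m n prot \<pi> g a" and Y: "Y \<in> Y_fiber m n prot \<pi> h b"
    and same: "\<forall>i<m. a ! i \<noteq> b ! i \<longrightarrow> X ! i = Y ! i"
  shows False
proof -
  have cons: "(g, X) \<in> consistent_inputs tA \<pi>" "(h, Y) \<in> consistent_inputs tB \<pi>"
    and ab: "map g X = a" "map h Y = b"
    using X Y by (auto simp: X_fiber_def Y_fiber_def X_of_def Y_of_def row_preimage_def)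
  have "live (\<pi> @ \<rho>) g = live (\<pi> @ \<rho>) h" "alice_speaks (\<pi> @ \<rho>) g = alice_speaks (\<pi> @ \<rho>) h"
    if "length \<rho> \<le> c" for \<rho>
    using colour that unfolding colour_def by blast+
  then obtain i j where "kwmux_valid m n (g, X) (h, Y) (Some (i, j))"
    using same_colour_output[of c \<pi> g h "[]" c X Y] depth \<open>live \<pi> g\<close> cons by auto
  then have "i < m" "a ! i \<noteq> b ! i" "X ! i ! j \<noteq> Y ! i ! j" by (auto simp: kwmux_valid_def ab)
  with same show False by simp
qed

lemma A_B_of_disjoint:
  "A_of m n f prot \<pi> g \<subseteq> cube m" "B_of m n f prot \<pi> g \<subseteq> cube m"
  "A_of m n f prot \<pi> g \<inter> B_of m n f prot \<pi> g = {}"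
  by (auto simp: A_of_def B_of_def)

lemma fiber_subset:
  "X_fiber m n prot \<pi> g a \<subseteq> row_preimage m n g a" "Y_fiber m n prot \<pi> g b \<subseteq> row_preimage m n g b"
  by (auto simp: X_fiber_def Y_fiber_def)

lemma V_of_live: "g \<in> V_of m n f prot \<pi> \<Longrightarrow> live \<pi> g"
  by (auto simp: V_of_def A_of_def B_of_def X_fiber_def Y_fiber_def live_def)

text \<open>A larger class contains \<open>g\<close> and \<open>h\<close> that split each other's
  test sets. Outside \<open>K\<close> both \<open>a\<close> and \<open>b\<close> agree with
  \<open>w\<close>, so they differ only at marked rows, where the common path makes \<open>X\<close>
  and \<open>Y\<close> equal.\<close>

lemma card_same_class_le:
  assumes "1 \<le> n" and depth: "tree_depth tA \<le> length \<pi> + c"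
    and S: "S \<subseteq> V_of m n f prot \<pi>" "S \<subseteq> balanced_funs n"
    and colour: "\<And>g h. g \<in> S \<Longrightarrow> h \<in> S \<Longrightarrow> colour \<pi> c g = colour \<pi> c h"
    and K: "K \<in> cube m" "length w = m"
    and a: "\<And>g. g \<in> S \<Longrightarrow> \<exists>a\<in>cube m. thick (29 / 100 * 2 ^ n) K (X_fiber m n prot \<pi> g a) \<and>
              (\<forall>i<m. \<not> K ! i \<longrightarrow> a ! i = w ! i)"
    and b: "\<And>g. g \<in> S \<Longrightarrow> \<exists>b\<in>cube m. thick (29 / 100 * 2 ^ n) K (Y_fiber m n prot \<pi> g b) \<and>
              (\<forall>i<m. \<not> K ! i \<longrightarrow> b ! i = w ! i)"
  shows "card S \<le> 2 * (2 ^ (m * n + 2 * m + 4) * 2 ^ 2 ^ n * exp (- (2 ^ n / 10000)))"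
proof (rule ccontr)
  let ?\<beta> = "2 ^ (m * n + 2 * m + 4) * 2 ^ 2 ^ n * exp (- (2 ^ n / 10000)) :: real"
  let ?X = "X_fiber m n prot \<pi>" and ?Y = "Y_fiber m n prot \<pi>"
  assume "\<not> real (card S) \<le> 2 * ?\<beta>"
  then have big: "2 * ?\<beta> < card S" by linarith
  have "finite (balanced_funs n)" by (simp add: balanced_funs_def)
  then have fin: "finite S" using S(2) by (rule rev_finite_subset)
  have finU: "finite (unbalancing m n g Z)" for g Z
    unfolding unbalancing_def by (intro finite_UN_I finite_test_sets finite_deviating)
  have "\<exists>g\<in>S. \<exists>h\<in>S. h \<notin> unbalancing m n g (?X g) \<and> g \<notin> unbalancing m n h (?Y h)"
  proof (rule exists_good_pair[OF fin _ _ _ big])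
    show "finite (unbalancing m n g (?X g)) \<and> real (card (unbalancing m n g (?X g))) \<le> ?\<beta>" for g
      by (intro conjI finU card_unbalancing_le \<open>1 \<le> n\<close> fiber_subset)
    show "finite (unbalancing m n g (?Y g)) \<and> real (card (unbalancing m n g (?Y g))) \<le> ?\<beta>" for g
      by (intro conjI finU card_unbalancing_le \<open>1 \<le> n\<close> fiber_subset)
  qed simp
  then obtain g h where gh: "g \<in> S" "h \<in> S" "h \<notin> unbalancing m n g (?X g)" "g \<notin> unbalancing m n h (?Y h)"
    by blast
  obtain a where a': "a \<in> cube m" "thick (29 / 100 * 2 ^ n) K (?X g a)" "\<forall>i<m. \<not> K ! i \<longrightarrow> a ! i = w ! i"
    using a[OF gh(1)] by blast
  obtain b where b': "b \<in> cube m" "thick (29 / 100 * 2 ^ n) K (?Y h b)" "\<forall>i<m. \<not> K ! i \<longrightarrow> b ! i = w ! i"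
    using b[OF gh(2)] by blast
  have bal: "g \<in> balanced_funs n" "h \<in> balanced_funs n" using gh S(2) by auto
  obtain X Y where XY: "X \<in> ?X g a" "Y \<in> ?Y h b" "\<forall>i<m. K ! i \<and> a ! i \<noteq> b ! i \<longrightarrow> X ! i = Y ! i"
    using weak_intersection[OF bal a'(1) b'(1) K(1) fiber_subset a'(2) b'(2) gh(3,4)] by blast
  have "\<forall>i<m. a ! i \<noteq> b ! i \<longrightarrow> X ! i = Y ! i" using XY(3) a'(3) b'(3) by metis
  moreover have "live \<pi> g" using V_of_live gh(1) S(1) by blast
  ultimately show False using not_weakly_intersecting[OF colour[OF gh(1,2)] depth _ XY(1,2)] by blast
qed

lemma common_mask_of_alive:
  assumes "1 \<le> n" "1 \<le> m" and g: "g \<in> V_of m n f prot \<pi>" "g \<in> balanced_funs n"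
    and L: "(1 - 1 / 24) * real m + kappa * log 2 (real m) + kappa \<le>
      log 2 (real (rect_formula_complexity m (A_of m n f prot \<pi> g) (B_of m n f prot \<pi> g)))"
    and dense: "\<forall>a\<in>A_of m n f prot \<pi> g. \<forall>b\<in>B_of m n f prot \<pi> g.
           2 powr (- (1 / 24) * real m + 1) * real (card (row_preimage m n g a)) \<le> real (card (X_fiber m n prot \<pi> g a)) \<and>
           2 powr (- (1 / 24) * real m + 1) * real (card (row_preimage m n g b)) \<le> real (card (Y_fiber m n prot \<pi> g b))"
  shows "\<exists>K\<in>cube m. \<exists>a\<in>cube m. \<exists>b\<in>cube m. thick (29 / 100 * 2 ^ n) K (X_fiber m n prot \<pi> g a) \<and>
      thick (29 / 100 * 2 ^ n) K (Y_fiber m n prot \<pi> g b) \<and> (\<forall>i<m. \<not> K ! i \<longrightarrow> a ! i = b ! i)"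
proof -
  let ?A = "A_of m n f prot \<pi> g" and ?B = "B_of m n f prot \<pi> g"
  \<comment> \<open>The density condition quantifies over \<open>a\<close> and \<open>b\<close>
    jointly, so each fiber needs a partner on the other side.\<close>
  obtain a0 b0 where "a0 \<in> ?A" "b0 \<in> ?B" using g(1) unfolding V_of_def by blast
  have weaken: "2 powr (- real m / 24) * x \<le> y" if "2 powr (- (1 / 24) * real m + 1) * x \<le> y" "0 \<le> x" for x y :: real
  proof -
    have "2 powr (- real m / 24) * x \<le> 2 powr (- (1 / 24) * real m + 1) * x"
      using that(2) by (intro mult_right_mono powr_mono) simp_all
    with that(1) show ?thesis by linarith
  qed
  have "\<exists>K\<in>cube m. \<exists>a\<in>?A. \<exists>b\<in>?B. thick (29 / 100 * 2 ^ n) K (X_fiber m n prot \<pi> g a) \<and>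
      thick (29 / 100 * 2 ^ n) K (Y_fiber m n prot \<pi> g b) \<and> (\<forall>i<m. \<not> K ! i \<longrightarrow> a ! i = b ! i)"
  proof (rule common_mask[OF g(2) assms(1,2) A_B_of_disjoint(1,2) fiber_subset])
    show "2 powr (- real m / 24) * real (card (row_preimage m n g a)) \<le> real (card (X_fiber m n prot \<pi> g a))"
      if "a \<in> ?A" for a using dense that \<open>b0 \<in> ?B\<close> by (intro weaken) simp_all
    show "2 powr (- real m / 24) * real (card (row_preimage m n g b)) \<le> real (card (Y_fiber m n prot \<pi> g b))"
      if "b \<in> ?B" for b using dense that \<open>a0 \<in> ?A\<close> by (intro weaken) simp_all
    show "23 / 24 * real m + 8 * log 2 (real m) + 8 \<le> log 2 (real (rect_formula_complexity m ?A ?B))"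
      using L by (simp add: kappa_def)
  qed
  then show ?thesis using A_B_of_disjoint(1,2) by blast
qed

text \<open>For \<open>m\<close> \<le> 1 the logarithmic term vanishes, also at 0 by the default
  value, and a complexity of at most 2 cannot have logarithm 8. Later, \<open>m\<close> \<ge> 2 lets
  log(mn) absorb constants.\<close>

lemma two_le_of_complex_rectangle:
  assumes "(1 - 1 / 24) * real m + kappa * log 2 (real m) + kappa \<le>
      log 2 (real (rect_formula_complexity m (A_of m n f prot \<pi> g) (B_of m n f prot \<pi> g)))"
  shows "2 \<le> m"
proof (rule ccontr)
  assume "\<not> 2 \<le> m"
  then have m: "m = 0 \<or> m = 1" by auto
  define L where "L = rect_formula_complexity m (A_of m n f prot \<pi> g) (B_of m n f prot \<pi> g)"
  have "log 2 (real m) = 0" using m by (auto simp: log_def)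
  then have "8 \<le> log 2 (real L)" using assms by (simp add: kappa_def L_def)
  moreover have "real L \<le> 2"
    using rect_formula_complexity_le_cube[OF A_B_of_disjoint] m unfolding L_def by fastforce
  moreover have "log 2 (real L) \<le> 1"
  proof (cases "L = 0")
    case False
    with \<open>real L \<le> 2\<close> have "log 2 (real L) \<le> log 2 2" by (intro log_mono) simp_all
    then show ?thesis by simp
  qed (simp add: log_def)
  ultimately show False by linarith
qed

text \<open>Pigeonhole: the live set has nearly 2^(2^n) functions, while each class misses that by a
  factor exponential in 2^n. Hence the number of classes, which is exponential in 2^c and m, must be
  large.\<close>

lemma alive_depth_bound:
  assumes alive: "alive (1 / 24) m n f prot \<pi>" and n: "1 \<le> n" and depth: "tree_depth tA \<le> length \<pi> + c"
  shows "2 \<le> m \<and> 2 ^ n \<le> 160000 * (real m * real n) * 2 ^ c"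
proof -
  obtain V where V: "V \<subseteq> V_of m n f prot \<pi>" "V \<subseteq> balanced_funs n"
    and cardV: "2 powr (- real m) * real (card (balanced_funs n)) \<le> real (card V)"
    and L: "\<forall>g\<in>V. (1 - 1 / 24) * real m + kappa * log 2 (real m) + kappa \<le>
      log 2 (real (rect_formula_complexity m (A_of m n f prot \<pi> g) (B_of m n f prot \<pi> g)))"
    and dense: "\<forall>g\<in>V. \<forall>a\<in>A_of m n f prot \<pi> g. \<forall>b\<in>B_of m n f prot \<pi> g.
           2 powr (- (1 / 24) * real m + 1) * real (card (row_preimage m n g a)) \<le> real (card (X_fiber m n prot \<pi> g a)) \<and>
           2 powr (- (1 / 24) * real m + 1) * real (card (row_preimage m n g b)) \<le> real (card (Y_fiber m n prot \<pi> g b))"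
    using alive unfolding alive_def by blast
  have "2 powr (- real m) * (2 ^ 2 ^ n / 2 ^ n) \<le> 2 powr (- real m) * real (card (balanced_funs n))"
    by (rule mult_left_mono[OF card_balanced_funs_ge[OF n]]) simp
  also note cardV
  finally have low: "2 powr (- real m) * (2 ^ 2 ^ n / 2 ^ n) \<le> real (card V)" .
  have "0 < (2 powr (- real m) * (2 ^ 2 ^ n / 2 ^ n) :: real)" by simp
  then have "0 < real (card V)" using low by linarith
  then have "V \<noteq> {}" by auto
  then have m: "2 \<le> m" using two_le_of_complex_rectangle L by blast
  define Q where "Q g t \<longleftrightarrow> (case t of (K, a, b) \<Rightarrow> K \<in> cube m \<and> a \<in> cube m \<and> b \<in> cube m \<and>
      thick (29 / 100 * 2 ^ n) K (X_fiber m n prot \<pi> g a) \<and>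
      thick (29 / 100 * 2 ^ n) K (Y_fiber m n prot \<pi> g b) \<and> (\<forall>i<m. \<not> K ! i \<longrightarrow> a ! i = b ! i))" for g t
  have "\<exists>t. Q g t" if "g \<in> V" for g
  proof -
    have "g \<in> V_of m n f prot \<pi>" "g \<in> balanced_funs n" "1 \<le> m" using that V m by auto
    from common_mask_of_alive[OF n this(3,1,2) bspec[OF L that] bspec[OF dense that]]
    show ?thesis unfolding Q_def by auto
  qed
  then have "\<forall>g\<in>V. \<exists>t. Q g t" by blast
  then obtain F where F: "\<forall>g\<in>V. Q g (F g)" by (rule bchoice[THEN exE])
  define K where "K g = fst (F g)" for g
  define a where "a g = fst (snd (F g))" for g
  define b where "b g = snd (snd (F g))" for g
  have "Q g (K g, a g, b g)" if "g \<in> V" for g using F that by (simp add: K_def a_def b_def)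
  then have Kab: "\<And>g. g \<in> V \<Longrightarrow> K g \<in> cube m" "\<And>g. g \<in> V \<Longrightarrow> a g \<in> cube m"
    "\<And>g. g \<in> V \<Longrightarrow> b g \<in> cube m"
    "\<And>g. g \<in> V \<Longrightarrow> thick (29 / 100 * 2 ^ n) (K g) (X_fiber m n prot \<pi> g (a g))"
    "\<And>g. g \<in> V \<Longrightarrow> thick (29 / 100 * 2 ^ n) (K g) (Y_fiber m n prot \<pi> g (b g))"
    "\<And>g i. g \<in> V \<Longrightarrow> i < m \<Longrightarrow> \<not> K g ! i \<Longrightarrow> a g ! i = b g ! i"
    unfolding Q_def by simp_all
  \<comment> \<open>The restriction of \<open>a g\<close> to the complement of the mask, padded with
    \<open>False\<close> inside so that it is again a point of the cube.\<close>
  define w where "w g = map2 (\<lambda>k x. \<not> k \<and> x) (K g) (a g)" for g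
  have w: "w g \<in> cube m" if "g \<in> V" for g
    using Kab(1,2)[OF that] by (simp add: w_def cube_def)
  have w_nth: "w g ! i = a g ! i" if "g \<in> V" "i < m" "\<not> K g ! i" for g i
    using Kab(1,2)[OF that(1)] that by (simp add: w_def cube_def)
  define P where "P = {\<rho> :: bool list. length \<rho> \<le> c}"
  define T where "T = (Pow P \<times> Pow P) \<times> cube m \<times> cube m"
  define \<Phi> where "\<Phi> g = (colour \<pi> c g, K g, w g)" for g
  define \<beta> where "\<beta> = 2 ^ (m * n + 2 * m + 4) * 2 ^ 2 ^ n * exp (- (2 ^ n / 10000 :: real))"
  have finP: "finite P" unfolding P_def by simp
  have finT: "finite T" unfolding T_def using finP by simp
  have "card P \<le> 2 * 2 ^ c"
    using card_lists_length_le[of "UNIV :: bool set" c] sum_powers_le[of 2 c] by (simp add: P_def)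
  have cardT: "card T = 2 ^ (2 * card P + 2 * m)"
    using finP by (simp add: T_def card_cartesian_product card_Pow card_cube power_add mult_2)
  have \<Phi>: "\<Phi> g \<in> T" if "g \<in> V" for g
    using Kab(1)[OF that] w[OF that] by (auto simp: \<Phi>_def T_def colour_def P_def)
  have cls: "real (card {g \<in> V. \<Phi> g = y}) \<le> 2 * \<beta>" for y
  proof (cases "\<exists>g\<in>V. \<Phi> g = y")
    case False
    then have empty: "{g \<in> V. \<Phi> g = y} = {}" by blast
    have "0 \<le> 2 * \<beta>" by (simp add: \<beta>_def)
    then show ?thesis unfolding empty by simp
  next
    case True
    then obtain g0 where g0: "g0 \<in> V" "\<Phi> g0 = y" by blast
    have eq: "colour \<pi> c g = colour \<pi> c g0" "K g = K g0" "w g = w g0" if "g \<in> {g \<in> V. \<Phi> g = y}" for g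
      using that g0 by (auto simp: \<Phi>_def)
    show ?thesis
      unfolding \<beta>_def
    proof (rule card_same_class_le[OF n depth, where K = "K g0" and w = "w g0"])
      show "\<exists>a\<in>cube m. thick (29 / 100 * 2 ^ n) (K g0) (X_fiber m n prot \<pi> g a) \<and>
          (\<forall>i<m. \<not> K g0 ! i \<longrightarrow> a ! i = w g0 ! i)" if "g \<in> {g \<in> V. \<Phi> g = y}" for g
      proof (intro bexI[of _ "a g"] conjI allI impI)
        have "g \<in> V" using that by simp
        then show "thick (29 / 100 * 2 ^ n) (K g0) (X_fiber m n prot \<pi> g (a g))" "a g \<in> cube m"
          using Kab(2,4)[of g] eq(2)[OF that] by simp_all
        show "a g ! i = w g0 ! i" if "i < m" "\<not> K g0 ! i" for i
          using w_nth[OF \<open>g \<in> V\<close> that(1)] that(2) eq(2,3)[OF \<open>g \<in> {g \<in> V. \<Phi> g = y}\<close>] by simp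
      qed
      show "\<exists>b\<in>cube m. thick (29 / 100 * 2 ^ n) (K g0) (Y_fiber m n prot \<pi> g b) \<and>
          (\<forall>i<m. \<not> K g0 ! i \<longrightarrow> b ! i = w g0 ! i)" if "g \<in> {g \<in> V. \<Phi> g = y}" for g
      proof (intro bexI[of _ "b g"] conjI allI impI)
        have "g \<in> V" using that by simp
        then show "thick (29 / 100 * 2 ^ n) (K g0) (Y_fiber m n prot \<pi> g (b g))" "b g \<in> cube m"
          using Kab(3,5)[of g] eq(2)[OF that] by simp_all
        \<comment> \<open>Outside the mask \<open>b g\<close> agrees with \<open>a g\<close>, so the
          same pattern serves Bob.\<close>
        show "b g ! i = w g0 ! i" if "i < m" "\<not> K g0 ! i" for i
          using w_nth[OF \<open>g \<in> V\<close> that(1)] Kab(6)[OF \<open>g \<in> V\<close> that(1)] that(2)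
            eq(2,3)[OF \<open>g \<in> {g \<in> V. \<Phi> g = y}\<close>] by simp
      qed
      show "colour \<pi> c g = colour \<pi> c h" if "g \<in> {g \<in> V. \<Phi> g = y}" "h \<in> {g \<in> V. \<Phi> g = y}" for g h
        using eq(1)[OF that(1)] eq(1)[OF that(2)] by simp
    qed (use V Kab(1)[OF g0(1)] w[OF g0(1)] in \<open>auto simp: cube_def\<close>)
  qed
  have "(\<Union>y\<in>T. {g \<in> V. \<Phi> g = y}) = V" using \<Phi> by blast
  moreover have "card (\<Union>y\<in>T. {g \<in> V. \<Phi> g = y}) \<le> (\<Sum>y\<in>T. card {g \<in> V. \<Phi> g = y})"
    by (rule card_UN_le[OF finT])
  ultimately have "card V \<le> (\<Sum>y\<in>T. card {g \<in> V. \<Phi> g = y})" by (simp only:)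
  then have "real (card V) \<le> (\<Sum>y\<in>T. real (card {g \<in> V. \<Phi> g = y}))"
    by (simp only: of_nat_sum[symmetric] of_nat_le_iff)
  also have "\<dots> \<le> (\<Sum>y\<in>T. 2 * \<beta>)" by (intro sum_mono cls)
  also have "\<dots> = 2 ^ (2 * card P + 2 * m) * (2 * \<beta>)" by (simp add: cardT)
  finally have up: "real (card V) \<le> 2 ^ (2 * card P + 2 * m) * (2 * \<beta>)" .
  \<comment> \<open>Collects the powers of 2: m + n from the size of the live set, 2 |P| + 2 m from
    the number of classes, the rest from \<open>2 * \<beta>\<close>. The factor 2^(2^n)
    cancels.\<close>
  define s where "s = 2 * card P + 5 * m + m * n + n + 5"
  have s: "s = m + n + (2 * card P + 2 * m) + 1 + (m * n + 2 * m + 4)" by (simp add: s_def)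
  define N where "N = (2 :: real) ^ 2 ^ n"
  define e where "e = exp (2 ^ n / 10000 :: real)"
  have e: "0 < e" and \<beta>: "\<beta> = 2 ^ (m * n + 2 * m + 4) * N * (1 / e)"
    by (simp_all add: \<beta>_def N_def e_def exp_minus inverse_eq_divide)
  have "1 / 2 ^ m * (N / 2 ^ n) \<le> 2 ^ (2 * card P + 2 * m) * (2 * \<beta>)"
    using order_trans[OF low up] by (simp only: powr_minus_divide powr_realpow N_def)
  then have "2 ^ m * 2 ^ n * (1 / 2 ^ m * (N / 2 ^ n)) * e \<le> 2 ^ m * 2 ^ n * (2 ^ (2 * card P + 2 * m) * (2 * \<beta>)) * e"
    using e by (intro mult_right_mono mult_left_mono) simp_all
  also have "2 ^ m * 2 ^ n * (1 / 2 ^ m * (N / 2 ^ n)) * e = N * e" by simp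
  also have "2 ^ m * 2 ^ n * (2 ^ (2 * card P + 2 * m) * (2 * \<beta>)) * e = N * 2 ^ s"
  proof -
    have "(2 :: real) ^ s = 2 ^ m * 2 ^ n * 2 ^ (2 * card P + 2 * m) * 2 * 2 ^ (m * n + 2 * m + 4)"
      unfolding s by (simp only: power_add power_one_right)
    moreover have "2 ^ m * 2 ^ n * (2 ^ (2 * card P + 2 * m) * (2 * \<beta>)) * e =
        N * (2 ^ m * 2 ^ n * 2 ^ (2 * card P + 2 * m) * 2 * 2 ^ (m * n + 2 * m + 4)) * (1 / e * e)"
      unfolding \<beta> by (simp only: mult_ac)
    ultimately show ?thesis using e by simp
  qed
  finally have "N * e \<le> N * 2 ^ s" .
  then have "e \<le> 2 ^ s" by (rule mult_left_le_imp_le) (simp add: N_def)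
  also have "(2 :: real) ^ s \<le> exp 1 ^ s"
    using exp_ge_add_one_self[of 1] by (intro power_mono) simp_all
  also have "\<dots> = exp (real s)" by (simp add: exp_of_nat_mult[symmetric])
  finally have "2 ^ n / 10000 \<le> real s" by (simp add: e_def)
  \<comment> \<open>With mn \<ge> 2 every term is bounded by a multiple of mn 2^c; 16 times 10000
    gives 160000.\<close>
  moreover have "real s \<le> 16 * (real m * real n * 2 ^ c)"
  proof -
    have "s \<le> 4 * 2 ^ c + 5 * m + m * n + n + 5" using \<open>card P \<le> 2 * 2 ^ c\<close> by (simp add: s_def)
    also have "\<dots> \<le> 2 * (m * n * 2 ^ c) + 14 * (m * n)"
    proof -
      have "2 * 1 \<le> m * n" "m * 1 \<le> m * n" "1 * n \<le> m * n" using m n by (intro mult_le_mono; simp)+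
      moreover have "2 * 2 ^ c \<le> m * n * 2 ^ c" using calculation(1) by (intro mult_le_mono1) simp
      ultimately show ?thesis by linarith
    qed
    also have "\<dots> \<le> 16 * (m * n * 2 ^ c)"
    proof -
      have "m * n * 1 \<le> m * n * 2 ^ c" by (intro mult_le_mono2) simp
      then show ?thesis by linarith
    qed
    finally have "real s \<le> real (16 * (m * n * 2 ^ c))" by (simp only: of_nat_le_iff)
    then show ?thesis by simp
  qed
  ultimately show ?thesis using m by simp
qed

end

section \<open>From the bound on 2^n to the bound on the depth\<close>

theorem theorem3p9:
  shows "\<exists>\<gamma>::real. \<gamma> > 0.04 \<and>
    (\<exists>C::real. \<forall>(m::nat) (n::nat) (f::bool list \<Rightarrow> bool) (prot::kwmux_protocol) (\<pi>\<^sub>1::bool list).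
       f \<in> bool_funs m \<longrightarrow>
       partially_half_duplex m n f prot \<longrightarrow>
       kwmux_solves m n f prot \<longrightarrow>
       alive \<gamma> m n f prot \<pi>\<^sub>1 \<longrightarrow>
       real (hd_complexity prot) \<ge> real (length \<pi>\<^sub>1) + real n - C * log 2 (real m * real n))"
\<comment> \<open>1/24 exceeds 0.04. The constant 19 is 18, from 160000 \<le> 2^18, plus 1 for the
  factor mn itself.\<close>
proof (rule exI[of _ "1 / 24"], intro conjI exI[of _ 19] allI impI)
  fix m n :: nat and f :: "bool list \<Rightarrow> bool" and prot :: kwmux_protocol and \<pi>\<^sub>1 :: "bool list"
  assume phd: "partially_half_duplex m n f prot" and solves: "kwmux_solves m n f prot"
    and alive: "alive (1 / 24) m n f prot \<pi>\<^sub>1"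
  interpret kwmux_protocol m n f prot by unfold_locales (fact phd, fact solves)
  have "consistent_inputs (fst prot) \<pi>\<^sub>1 \<noteq> {}" using alive by (simp add: alive_def is_transcript_def)
  then obtain p u where p: "map edge_bit p = \<pi>\<^sub>1" "vertex_at (fst prot) p = Some u"
    unfolding consistent_inputs_def by blast
  have len: "length \<pi>\<^sub>1 \<le> hd_complexity prot"
    using vertex_at_depth[OF p(2)] p(1) by (auto simp: hd_complexity_def)
  define c where "c = hd_complexity prot - length \<pi>\<^sub>1"
  have c: "hd_complexity prot = length \<pi>\<^sub>1 + c" using len by (simp add: c_def)
  show "real (length \<pi>\<^sub>1) + real n - 19 * log 2 (real m * real n) \<le> real (hd_complexity prot)"
  \<comment> \<open>For n = 0 the logarithm has the default value 0, and the claim says only that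
    the transcript fits into the tree.\<close>
  proof (cases "n = 0")
    case True
    then show ?thesis using len by (simp add: log_def)
  next
    case False
    then have "1 \<le> n" by simp
    have "tree_depth tA \<le> length \<pi>\<^sub>1 + c" using c by (simp add: hd_complexity_def)
    from alive_depth_bound[OF alive \<open>1 \<le> n\<close> this]
    have m: "2 \<le> m" and bound: "2 ^ n \<le> 160000 * (real m * real n) * 2 ^ c" by auto
    let ?mn = "real m * real n"
    have mn: "2 \<le> ?mn" using m \<open>1 \<le> n\<close> mult_mono[of 2 "real m" 1 "real n"] by simp
    have "real n = log 2 (2 ^ n)" by simp
    also have "\<dots> \<le> log 2 (2 ^ 18 * ?mn * 2 ^ c)"
    proof (rule log_mono)
      have "160000 * ?mn * 2 ^ c \<le> 2 ^ 18 * ?mn * 2 ^ c" using mn by (intro mult_right_mono) simp_all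
      with bound show "2 ^ n \<le> 2 ^ 18 * ?mn * 2 ^ c" by linarith
    qed simp_all
    also have "\<dots> = log 2 (2 ^ 18) + log 2 ?mn + log 2 (2 ^ c)"
      using mn m \<open>1 \<le> n\<close> by (simp add: log_mult)
    also have "\<dots> = 18 + log 2 ?mn + c" using log_pow_cancel[of 2 18] by simp
    \<comment> \<open>Since mn \<ge> 2, its logarithm is at least 1 and absorbs the additive
      constant.\<close>
    also have "18 \<le> 18 * log 2 ?mn" using log_mono[of 2 2 ?mn] mn by simp
    finally show ?thesis using c by simp
  qed
qed simp

end
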